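(* For every operator space $V$, the space $\mathcal{H}^\infty_{\mathrm{cb}}(B_V)$ of scalar-valued completely bounded holomorphic functions is a dual operator space. In fact, the subspace $\mathcal{G}^\infty_{\mathrm{cb}}(B_V)=\overline{\operatorname{span}}\{\delta_V(x) : x\in B_V\}\subseteq \mathcal{H}^\infty_{\mathrm{cb}}(B_V)'$, with the operator space structure inherited from $\mathcal{H}^\infty_{\mathrm{cb}}(B_V)'$, is an operator space predual of $\mathcal{H}^\infty_{\mathrm{cb}}(B_V)$.
   Context: All spaces are complex and complete; $X'$ is the dual of $X$, $B_X$ is the open unit ball of $X$. For an operator space $V$, $M_n(V)$ is the space of $n\times n$ matrices over $V$ with its given norm; the dual $V'$ has the operator space structure $M_n(V')=\mathcal{CB}(V,M_n)$. A map $f:B_V\to W$ ($V,W$ operator spaces) is holomorphic if it is (complex) Fréchet differentiable at every point. A holomorphic $f:B_V\to W$ is completely bounded holomorphic if $\|f\|_{\mathcal{H}^\infty_{\mathrm{cb}}}=\sup\{\|(f(x_{ij}))\|_{M_m(W)} : m\in\mathbb N,\ (x_{ij})\in B_{M_m(V)}\}<\infty$. The space of these is $\mathcal{H}^\infty_{\mathrm{cb}}(B_V,W)$, an operator space with matrix norms $\|(f_{k\ell})\|_{M_n(\mathcal{H}^\infty_{\mathrm{cb}}(B_V,W))}=\sup\{\|(f_{k\ell}(x_{ij}))\|_{M_{mn}(W)} : m\in\mathbb N,\ (x_{ij})\in B_{M_m(V)}\}$. Write $\mathcal{H}^\infty_{\mathrm{cb}}(B_V)=\mathcal{H}^\infty_{\mathrm{cb}}(B_V,\mathbb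 C)$. For $x\in B_V$, $\delta_V(x)\in\mathcal{H}^\infty_{\mathrm{cb}}(B_V)'$ is the evaluation functional $f\mapsto f(x)$. An operator space $E$ is a dual operator space if it is completely isometrically isomorphic to $G'$ for some operator space $G$. A closed subspace $G\subseteq E'$ (with inherited operator space structure) is an operator space predual of $E$ if the canonical map $E\to G'$, $e\mapsto (g\mapsto g(e))$, is a completely isometric isomorphism onto $G'$. *)

theory Defs
  imports "HOL-Analysis.Analysis" "HOL-Library.Function_Algebras"
begin

section \<open>Complex vector spaces\<close>

class complex_vector = ab_group_add +
  fixes scaleC :: "complex \<Rightarrow> 'a \<Rightarrow> 'a"  (infixr \<open>*\<^sub>C\<close> 75)
  assumes scaleC_add_right: "a *\<^sub>C (x + y) = a *\<^sub>C x + a *\<^sub>C y"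
    and scaleC_add_left: "(a + b) *\<^sub>C x = a *\<^sub>C x + b *\<^sub>C x"
    and scaleC_scaleC: "a *\<^sub>C (b *\<^sub>C x) = (a * b) *\<^sub>C x"
    and scaleC_one: "1 *\<^sub>C x = x"

global_interpretation complex_vector: vector_space "scaleC :: complex \<Rightarrow> 'a \<Rightarrow> 'a::complex_vector"
  defines csubspace = complex_vector.subspace
    and cspan = complex_vector.span
  by unfold_locales (simp_all add: scaleC_add_right scaleC_add_left scaleC_scaleC scaleC_one)

instantiation complex :: complex_vector
begin
definition scaleC_complex :: "complex \<Rightarrow> complex \<Rightarrow> complex" where
  "scaleC_complex c z = c * z"
instance by standard (simp_all add: scaleC_complex_def algebra_simps)
end

instantiation "fun" :: (type, complex_vector) complex_vector
begin
definition scaleC_fun :: "complex \<Rightarrow> ('a \<Rightarrow> 'b) \<Rightarrow> 'a \<Rightarrow> 'b" where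
  "scaleC_fun c f = (\<lambda>x. c *\<^sub>C f x)"
instance
  by standard (simp_all add: scaleC_fun_def fun_eq_iff scaleC_add_right scaleC_add_left
      scaleC_scaleC scaleC_one)
end

section \<open>Operator spaces\<close>

text \<open>
  An \<open>n \<times> n\<close> matrix over a space is a function \<open>nat \<Rightarrow> nat \<Rightarrow> 'a\<close> of which only the entries with
  indices below \<open>n\<close> matter. The number \<open>mnorm V n X\<close> is the norm of \<open>X\<close> in \<open>M\<^sub>n(V)\<close>; it is
  only meaningful for \<open>n > 0\<close> and \<open>X \<in> mats V n\<close>.
\<close>

record 'a opspace =
  carrier :: "'a set"
  mnorm :: "nat \<Rightarrow> (nat \<Rightarrow> nat \<Rightarrow> 'a) \<Rightarrow> real"

definition mats :: "'a opspace \<Rightarrow> nat \<Rightarrow> (nat \<Rightarrow> nat \<Rightarrow> 'a) set" where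
  "mats V n = {X. \<forall>i<n. \<forall>j<n. X i j \<in> carrier V}"

definition mat_ball :: "'a opspace \<Rightarrow> nat \<Rightarrow> (nat \<Rightarrow> nat \<Rightarrow> 'a) set" where
  "mat_ball V n = {X \<in> mats V n. mnorm V n X < 1}"

text \<open>The Banach space norm of \<open>V\<close> is the norm of \<open>M\<^sub>1(V)\<close>.\<close>

definition os_norm :: "'a opspace \<Rightarrow> 'a \<Rightarrow> real" where
  "os_norm V x = mnorm V 1 (\<lambda>i j. x)"

definition unit_ball :: "'a opspace \<Rightarrow> 'a set" where
  "unit_ball V = {x \<in> carrier V. os_norm V x < 1}"

text \<open>The case distinction only serves to meet the axioms of \<^locale>\<open>Metric_space\<close>, which are
  imposed on the distance function also outside of the carrier.\<close>

definition os_dist :: "'a::complex_vector opspace \<Rightarrow> 'a \<Rightarrow> 'a \<Rightarrow> real" where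
  "os_dist V x y = (if x \<in> carrier V \<and> y \<in> carrier V then os_norm V (x - y) else 0)"

definition os_topology :: "'a::complex_vector opspace \<Rightarrow> 'a topology" where
  "os_topology V = Metric_space.mtopology (carrier V) (os_dist V)"

text \<open>Operator norm of the \<open>r \<times> c\<close> matrix \<open>A\<close> as a map of Hilbert spaces from \<open>\<complex>\<^sup>c\<close> to \<open>\<complex>\<^sup>r\<close>.\<close>

definition cmat_norm :: "nat \<Rightarrow> nat \<Rightarrow> (nat \<Rightarrow> nat \<Rightarrow> complex) \<Rightarrow> real" where
  "cmat_norm r c A =
     Sup {L2_set (\<lambda>i. cmod (\<Sum>j<c. A i j * z j)) {..<r} | z. L2_set (\<lambda>j. cmod (z j)) {..<c} \<le> 1}"

text \<open>The product \<open>\<alpha> X \<beta>\<close> of an \<open>n \<times> m\<close> scalar matrix, an \<open>m \<times> m\<close> matrix over the space and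
  an \<open>m \<times> n\<close> scalar matrix.\<close>

definition mat_bimult ::
  "nat \<Rightarrow> (nat \<Rightarrow> nat \<Rightarrow> complex) \<Rightarrow> (nat \<Rightarrow> nat \<Rightarrow> 'a::complex_vector) \<Rightarrow> (nat \<Rightarrow> nat \<Rightarrow> complex)
    \<Rightarrow> nat \<Rightarrow> nat \<Rightarrow> 'a" where
  "mat_bimult m \<alpha> X \<beta> = (\<lambda>i j. \<Sum>k<m. \<Sum>l<m. (\<alpha> i k * \<beta> l j) *\<^sub>C X k l)"

definition mat_dsum ::
  "nat \<Rightarrow> (nat \<Rightarrow> nat \<Rightarrow> 'a::zero) \<Rightarrow> (nat \<Rightarrow> nat \<Rightarrow> 'a) \<Rightarrow> nat \<Rightarrow> nat \<Rightarrow> 'a" where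
  "mat_dsum m X Y = (\<lambda>i j. if i < m \<and> j < m then X i j
                           else if m \<le> i \<and> m \<le> j then Y (i - m) (j - m) else 0)"

text \<open>Complete operator spaces, by Ruan's axioms. Completeness of \<open>V = M\<^sub>1(V)\<close> entails that of
  all \<open>M\<^sub>n(V)\<close>.\<close>

locale operator_space =
  fixes V :: "'a::complex_vector opspace"
  assumes subspace_carrier: "csubspace (carrier V)"
    and mnorm_cong: "\<lbrakk>0 < n; X \<in> mats V n; \<And>i j. \<lbrakk>i < n; j < n\<rbrakk> \<Longrightarrow> X i j = Y i j\<rbrakk>
          \<Longrightarrow> mnorm V n X = mnorm V n Y"
    and mnorm_triangle: "\<lbrakk>0 < n; X \<in> mats V n; Y \<in> mats V n\<rbrakk>
          \<Longrightarrow> mnorm V n (\<lambda>i j. X i j + Y i j) \<le> mnorm V n X + mnorm V n Y"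
    and mnorm_scaleC: "\<lbrakk>0 < n; X \<in> mats V n\<rbrakk>
          \<Longrightarrow> mnorm V n (\<lambda>i j. c *\<^sub>C X i j) = cmod c * mnorm V n X"
    and mnorm_eq_0: "\<lbrakk>0 < n; X \<in> mats V n; mnorm V n X = 0; i < n; j < n\<rbrakk> \<Longrightarrow> X i j = 0"
    and mnorm_bimult: "\<lbrakk>0 < m; 0 < n; X \<in> mats V m\<rbrakk>
          \<Longrightarrow> mnorm V n (mat_bimult m \<alpha> X \<beta>) \<le> cmat_norm n m \<alpha> * mnorm V m X * cmat_norm m n \<beta>"
    and mnorm_dsum: "\<lbrakk>0 < m; 0 < n; X \<in> mats V m; Y \<in> mats V n\<rbrakk>
          \<Longrightarrow> mnorm V (m + n) (mat_dsum m X Y) = max (mnorm V m X) (mnorm V n Y)"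
    and complete: "Metric_space.mcomplete (carrier V) (os_dist V)"

definition scalar_space :: "complex opspace" where
  "scalar_space = \<lparr>carrier = UNIV, mnorm = (\<lambda>n. cmat_norm n n)\<rparr>"

section \<open>Linear maps and duals\<close>

definition clinear_map :: "'a::complex_vector opspace \<Rightarrow> 'b::complex_vector opspace \<Rightarrow> ('a \<Rightarrow> 'b) \<Rightarrow> bool"
  where "clinear_map V W T \<longleftrightarrow> T ` carrier V \<subseteq> carrier W
    \<and> (\<forall>x \<in> carrier V. \<forall>y \<in> carrier V. T (x + y) = T x + T y)
    \<and> (\<forall>c. \<forall>x \<in> carrier V. T (c *\<^sub>C x) = c *\<^sub>C T x)"

definition bounded_clinear_map ::
  "'a::complex_vector opspace \<Rightarrow> 'b::complex_vector opspace \<Rightarrow> ('a \<Rightarrow> 'b) \<Rightarrow> bool"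
  where "bounded_clinear_map V W T \<longleftrightarrow> clinear_map V W T
    \<and> (\<exists>C. \<forall>x \<in> carrier V. os_norm W (T x) \<le> C * os_norm V x)"

definition completely_isometric_iso ::
  "'a::complex_vector opspace \<Rightarrow> 'b::complex_vector opspace \<Rightarrow> ('a \<Rightarrow> 'b) \<Rightarrow> bool"
  where "completely_isometric_iso V W T \<longleftrightarrow> clinear_map V W T
    \<and> bij_betw T (carrier V) (carrier W)
    \<and> (\<forall>n>0. \<forall>X \<in> mats V n. mnorm W n (\<lambda>i j. T (X i j)) = mnorm V n X)"

text \<open>
  For an \<open>n \<times> n\<close> matrix \<open>F = (f\<^sub>k\<^sub>l)\<close> of functions and an \<open>m \<times> m\<close> matrix \<open>X = (x\<^sub>i\<^sub>j)\<close>, the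
  \<open>nm \<times> nm\<close> matrix \<open>(f\<^sub>k\<^sub>l(x\<^sub>i\<^sub>j))\<close>, with row index \<open>k m + i\<close> and column index \<open>l m + j\<close>. (The order
  in which the index pairs are enumerated does not affect norms: a permutation is unitary.)
\<close>

definition mat_apply ::
  "nat \<Rightarrow> (nat \<Rightarrow> nat \<Rightarrow> 'a \<Rightarrow> 'b) \<Rightarrow> (nat \<Rightarrow> nat \<Rightarrow> 'a) \<Rightarrow> nat \<Rightarrow> nat \<Rightarrow> 'b" where
  "mat_apply m F X = (\<lambda>p q. F (p div m) (q div m) (X (p mod m) (q mod m)))"

definition amp_values ::
  "'a opspace \<Rightarrow> 'b opspace \<Rightarrow> nat \<Rightarrow> (nat \<Rightarrow> nat \<Rightarrow> 'a \<Rightarrow> 'b) \<Rightarrow> real set" where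
  "amp_values V W n F = {mnorm W (n * m) (mat_apply m F X) | m X. 0 < m \<and> X \<in> mat_ball V m}"

definition amp_norm ::
  "'a opspace \<Rightarrow> 'b opspace \<Rightarrow> nat \<Rightarrow> (nat \<Rightarrow> nat \<Rightarrow> 'a \<Rightarrow> 'b) \<Rightarrow> real" where
  "amp_norm V W n F = Sup (amp_values V W n F)"

text \<open>
  A function on a subset of a type is represented by its extension by zero to the whole type, so
  that the vector space operations of function spaces are the pointwise ones of the function type.

  An \<open>n \<times> n\<close> matrix of functionals is a linear map from \<open>V\<close> to \<open>M\<^sub>n\<close>, and \<open>amp_norm\<close> is its
  completely bounded norm, because \<open>M\<^sub>m(M\<^sub>n) = M\<^sub>n\<^sub>m\<close>.
\<close>

definition dual_space :: "'a::complex_vector opspace \<Rightarrow> ('a \<Rightarrow> complex) opspace" where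
  "dual_space V =
     \<lparr>carrier = {\<phi>. bounded_clinear_map V scalar_space \<phi> \<and> (\<forall>x. x \<notin> carrier V \<longrightarrow> \<phi> x = 0)},
      mnorm = amp_norm V scalar_space\<rparr>"

text \<open>
  Every \<open>G\<close> with \<open>E = G'\<close> is completely isometrically isomorphic to a subspace of \<open>E'\<close>. Hence it
  is no restriction to let \<open>G\<close> range over the operator spaces whose elements are functions on \<open>E\<close>.
\<close>

definition dual_operator_space :: "'e::complex_vector opspace \<Rightarrow> bool" where
  "dual_operator_space E \<longleftrightarrow> operator_space E
     \<and> (\<exists>(G :: ('e \<Rightarrow> complex) opspace) T.
           operator_space G \<and> completely_isometric_iso E (dual_space G) T)"

definition sub_opspace :: "'a opspace \<Rightarrow> 'a set \<Rightarrow> 'a opspace" where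
  "sub_opspace V S = \<lparr>carrier = S, mnorm = mnorm V\<rparr>"

definition canonical_map :: "('e \<Rightarrow> complex) set \<Rightarrow> 'e \<Rightarrow> ('e \<Rightarrow> complex) \<Rightarrow> complex" where
  "canonical_map G e = (\<lambda>g. if g \<in> G then g e else 0)"

definition operator_space_predual :: "'e::complex_vector opspace \<Rightarrow> ('e \<Rightarrow> complex) set \<Rightarrow> bool" where
  "operator_space_predual E G \<longleftrightarrow>
     csubspace G \<and> closedin (os_topology (dual_space E)) G
     \<and> completely_isometric_iso E (dual_space (sub_opspace (dual_space E) G)) (canonical_map G)"

section \<open>Completely bounded holomorphic functions\<close>

definition frechet_differentiable_at ::
  "'a::complex_vector opspace \<Rightarrow> 'b::complex_vector opspace \<Rightarrow> ('a \<Rightarrow> 'b) \<Rightarrow> 'a \<Rightarrow> bool" where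
  "frechet_differentiable_at V W f x \<longleftrightarrow>
     (\<exists>D. bounded_clinear_map V W D \<and>
        (\<forall>\<epsilon>>0. \<exists>\<delta>>0. \<forall>h \<in> carrier V. os_norm V h < \<delta> \<longrightarrow> x + h \<in> unit_ball V \<longrightarrow>
            os_norm W (f (x + h) - f x - D h) \<le> \<epsilon> * os_norm V h))"

definition holomorphic_ball ::
  "'a::complex_vector opspace \<Rightarrow> 'b::complex_vector opspace \<Rightarrow> ('a \<Rightarrow> 'b) \<Rightarrow> bool" where
  "holomorphic_ball V W f \<longleftrightarrow> f ` unit_ball V \<subseteq> carrier W
     \<and> (\<forall>x \<in> unit_ball V. frechet_differentiable_at V W f x)"

definition Hcb :: "'a::complex_vector opspace \<Rightarrow> 'b::complex_vector opspace \<Rightarrow> ('a \<Rightarrow> 'b) opspace" where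
  "Hcb V W =
     \<lparr>carrier = {f. holomorphic_ball V W f \<and> bdd_above (amp_values V W 1 (\<lambda>k l. f))
                    \<and> (\<forall>x. x \<notin> unit_ball V \<longrightarrow> f x = 0)},
      mnorm = amp_norm V W\<rparr>"

definition evaluation :: "'a::complex_vector opspace \<Rightarrow> 'a \<Rightarrow> ('a \<Rightarrow> complex) \<Rightarrow> complex" where
  "evaluation V x = (\<lambda>f. if f \<in> carrier (Hcb V scalar_space) then f x else 0)"

definition Gcb :: "'a::complex_vector opspace \<Rightarrow> (('a \<Rightarrow> complex) \<Rightarrow> complex) set" where
  "Gcb V = os_topology (dual_space (Hcb V scalar_space))
             closure_of cspan (evaluation V ` unit_ball V)"

end

(* Every scalar function f in H = Hcb V factors as f = phi o delta through the evaluation map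
   delta, where phi is the functional g |-> g(f) on the closed span G of the evaluations. Since
   delta maps matrix balls of V into the closed matrix balls of H', the norm of a matrix over H
   equals the norm of the corresponding matrix of functionals on G. Conversely, for phi in G' the
   function phi o delta lies in H: functionals are automatically completely bounded, and the Cauchy
   estimates, being uniform over the unit ball of H, show that the difference quotients of delta
   converge in the norm of H', so that the derivative of delta takes its values in G. Finally,
   phi and g |-> g(phi o delta) agree on the evaluations, hence on G. *)

theory Submission
  imports Defs "HOL-Complex_Analysis.Complex_Analysis"
begin

section \<open>The operator norm of scalar matrices\<close>

text \<open>H and the duals alike consist of scalar functions whose matrix norms are suprema over
  the matrix balls of the underlying space. Ruan's axioms and the completeness argument are
  therefore proved once, in the locale \<open>amp_space\<close>; what differs is why limits stay in
  the space, namely linearity for duals and Cauchy estimates for H. The matrix (f_kl(x_ij)) can be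
  read as functions applied to points or as evaluations applied to functions. The two readings
  differ by a permutation of index pairs, which is unitary, and this is why the matrix norms of H
  and G' match. The obstacle in the converse direction is that phi is only known to be linear and
  bounded on G. So delta has to be differentiated in norm, inside G, and its derivative is written
  down explicitly: the functional sending f to its derivative at x along a complex line.
  One-variable Cauchy estimates on that line give a bound and a quadratic remainder, both linear in
  the supremum of f; this linearity turns estimates for single functions into norm estimates in
  H'.\<close>

definition vec_norm :: "nat \<Rightarrow> (nat \<Rightarrow> complex) \<Rightarrow> real" where
  "vec_norm n z = L2_set (\<lambda>i. cmod (z i)) {..<n}"

definition mat_vec :: "nat \<Rightarrow> (nat \<Rightarrow> nat \<Rightarrow> complex) \<Rightarrow> (nat \<Rightarrow> complex) \<Rightarrow> nat \<Rightarrow> complex" where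
  "mat_vec c A z = (\<lambda>i. \<Sum>j<c. A i j * z j)"

lemma vec_norm_nonneg [simp]: "0 \<le> vec_norm n z"
  by (simp add: vec_norm_def)

lemma vec_norm_zero [simp]: "vec_norm n (\<lambda>i. 0) = 0"
  by (simp add: vec_norm_def L2_set_def)

lemma vec_norm_power2: "(vec_norm n z)\<^sup>2 = (\<Sum>i<n. (cmod (z i))\<^sup>2)"
  by (simp add: vec_norm_def L2_set_def sum_nonneg)

lemma vec_norm_cong: "(\<And>i. i < n \<Longrightarrow> z i = w i) \<Longrightarrow> vec_norm n z = vec_norm n w"
  unfolding vec_norm_def by (rule L2_set_cong) auto

lemma vec_norm_scale: "vec_norm n (\<lambda>i. c * z i) = cmod c * vec_norm n z"
  by (simp add: vec_norm_def norm_mult L2_set_right_distrib)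

lemma vec_norm_triangle: "vec_norm n (\<lambda>i. z i + w i) \<le> vec_norm n z + vec_norm n w"
proof -
  have "vec_norm n (\<lambda>i. z i + w i) \<le> L2_set (\<lambda>i. cmod (z i) + cmod (w i)) {..<n}"
    unfolding vec_norm_def by (rule L2_set_mono) (auto intro: norm_triangle_ineq)
  also have "\<dots> \<le> vec_norm n z + vec_norm n w"
    unfolding vec_norm_def by (rule L2_set_triangle_ineq)
  finally show ?thesis .
qed

lemma cmod_le_vec_norm: "i < n \<Longrightarrow> cmod (z i) \<le> vec_norm n z"
  unfolding vec_norm_def by (rule member_le_L2_set[where f = "\<lambda>i. cmod (z i)"]) auto

lemma cmod_sum_mult_le: "cmod (\<Sum>i<n. z i * w i) \<le> vec_norm n z * vec_norm n w"
proof -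
  have "cmod (\<Sum>i<n. z i * w i) \<le> (\<Sum>i<n. \<bar>cmod (z i)\<bar> * \<bar>cmod (w i)\<bar>)"
    by (rule order_trans[OF norm_sum]) (simp add: norm_mult)
  also have "\<dots> \<le> vec_norm n z * vec_norm n w"
    unfolding vec_norm_def by (rule L2_set_mult_ineq)
  finally show ?thesis .
qed

lemma vec_norm_one [simp]: "vec_norm (Suc 0) z = cmod (z 0)"
  by (simp add: vec_norm_def L2_set_def)

lemma vec_norm_if_eq: "k < n \<Longrightarrow> vec_norm n (\<lambda>i. if i = k then 1 else 0) = 1"
proof -
  assume "k < n"
  then have "(vec_norm n (\<lambda>i. if i = k then 1 else 0))\<^sup>2 = 1"
    unfolding vec_norm_power2 by (simp add: if_distrib[of cmod] if_distrib[of "\<lambda>x. x\<^sup>2"] sum.delta cong: if_cong)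
  then show ?thesis by (simp add: power2_eq_1_iff) (metis vec_norm_nonneg neg_0_le_iff_le not_one_le_zero)
qed

lemma cmat_norm_eq: "cmat_norm r c A = Sup {vec_norm r (mat_vec c A z) | z. vec_norm c z \<le> 1}"
  by (simp add: cmat_norm_def vec_norm_def mat_vec_def)

text \<open>A crude entrywise bound. It makes the set under \<open>Sup\<close> bounded above, so
  that the supremum is meaningful, and later shows that entrywise convergence of matrices of fixed
  size is norm convergence.\<close>

lemma vec_norm_mat_vec_le_sum:
  assumes "vec_norm c z \<le> 1"
  shows "vec_norm r (mat_vec c A z) \<le> (\<Sum>i<r. \<Sum>j<c. cmod (A i j))"
proof -
  have "vec_norm r (mat_vec c A z) \<le> (\<Sum>i<r. cmod (mat_vec c A z i))"
    unfolding vec_norm_def by (rule L2_set_le_sum) auto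
  also have "\<dots> \<le> (\<Sum>i<r. \<Sum>j<c. cmod (A i j))"
  proof (rule sum_mono)
    fix i
    have "cmod (mat_vec c A z i) \<le> (\<Sum>j<c. cmod (A i j) * cmod (z j))"
      unfolding mat_vec_def by (rule order_trans[OF norm_sum]) (simp add: norm_mult)
    also have "\<dots> \<le> (\<Sum>j<c. cmod (A i j) * 1)"
      using assms cmod_le_vec_norm[of _ c z]
      by (intro sum_mono mult_left_mono) (force intro: order_trans)+
    finally show "cmod (mat_vec c A z i) \<le> (\<Sum>j<c. cmod (A i j))" by simp
  qed
  finally show ?thesis .
qed

lemma bdd_above_mat_vec: "bdd_above {vec_norm r (mat_vec c A z) | z. vec_norm c z \<le> 1}"
  using vec_norm_mat_vec_le_sum by (auto intro!: bdd_aboveI)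

lemma cmat_norm_le_sum: "cmat_norm r c A \<le> (\<Sum>i<r. \<Sum>j<c. cmod (A i j))"
  unfolding cmat_norm_eq
  by (rule cSup_least) (use vec_norm_mat_vec_le_sum in \<open>auto intro: exI[of _ "\<lambda>i. 0"]\<close>)

lemma cmat_norm_leI_unit:
  assumes "\<And>z. vec_norm c z \<le> 1 \<Longrightarrow> vec_norm r (mat_vec c A z) \<le> K"
  shows "cmat_norm r c A \<le> K"
  unfolding cmat_norm_eq
  by (rule cSup_least) (use assms in \<open>auto intro: exI[of _ "\<lambda>i. 0"]\<close>)

lemma cmat_norm_leI:
  assumes "0 \<le> K" "\<And>z. vec_norm r (mat_vec c A z) \<le> K * vec_norm c z"
  shows "cmat_norm r c A \<le> K"
proof (rule cmat_norm_leI_unit)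
  fix z assume "vec_norm c z \<le> 1"
  with assms(1) have "K * vec_norm c z \<le> K * 1" by (intro mult_left_mono)
  with assms(2)[of z] show "vec_norm r (mat_vec c A z) \<le> K" by simp
qed

lemma vec_norm_mat_vec_le_unit:
  "vec_norm c z \<le> 1 \<Longrightarrow> vec_norm r (mat_vec c A z) \<le> cmat_norm r c A"
  unfolding cmat_norm_eq by (rule cSup_upper[OF _ bdd_above_mat_vec]) auto

lemma cmat_norm_nonneg [simp]: "0 \<le> cmat_norm r c A"
  by (rule order_trans[OF vec_norm_nonneg vec_norm_mat_vec_le_unit[of c "\<lambda>i. 0"]]) simp

lemma vec_norm_mat_vec_le: "vec_norm r (mat_vec c A z) \<le> cmat_norm r c A * vec_norm c z"
proof (cases "vec_norm c z = 0")
  case True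
  then have "z j = 0" if "j < c" for j
    using cmod_le_vec_norm[OF that, of z] by simp
  then have "mat_vec c A z = (\<lambda>i. 0)"
    by (simp add: mat_vec_def)
  then show ?thesis by simp
next
  case False
  define t where "t = vec_norm c z"
  have t: "t > 0" using False by (simp add: t_def order_less_le)
  have "vec_norm c (\<lambda>j. of_real (1 / t) * z j) \<le> 1"
    using t by (subst vec_norm_scale) (simp add: norm_divide flip: t_def)
  then have "vec_norm r (mat_vec c A (\<lambda>j. of_real (1 / t) * z j)) \<le> cmat_norm r c A"
    by (rule vec_norm_mat_vec_le_unit)
  moreover have "mat_vec c A (\<lambda>j. of_real (1 / t) * z j) = (\<lambda>i. of_real (1 / t) * mat_vec c A z i)"
    by (simp add: mat_vec_def sum_distrib_left mult_ac)
  ultimately have "(1 / t) * vec_norm r (mat_vec c A z) \<le> cmat_norm r c A"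
    using t by (simp only: vec_norm_scale norm_of_real) simp
  then show ?thesis using t unfolding t_def[symmetric] by (simp add: pos_divide_le_eq)
qed

lemma mat_vec_cong: "(\<And>j. j < c \<Longrightarrow> A i j = B i j) \<Longrightarrow> mat_vec c A z i = mat_vec c B z i"
  by (simp add: mat_vec_def)

lemma cmat_norm_cong:
  assumes "\<And>i j. i < r \<Longrightarrow> j < c \<Longrightarrow> A i j = B i j"
  shows "cmat_norm r c A = cmat_norm r c B"
proof -
  have "vec_norm r (mat_vec c A z) = vec_norm r (mat_vec c B z)" for z
    using assms by (intro vec_norm_cong mat_vec_cong) auto
  then show ?thesis by (simp add: cmat_norm_eq)
qed

lemma cmat_norm_triangle: "cmat_norm r c (\<lambda>i j. A i j + B i j) \<le> cmat_norm r c A + cmat_norm r c B"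
proof (rule cmat_norm_leI)
  fix z
  have "mat_vec c (\<lambda>i j. A i j + B i j) z = (\<lambda>i. mat_vec c A z i + mat_vec c B z i)"
    by (simp add: mat_vec_def sum.distrib algebra_simps)
  then have "vec_norm r (mat_vec c (\<lambda>i j. A i j + B i j) z) \<le> vec_norm r (mat_vec c A z) + vec_norm r (mat_vec c B z)"
    using vec_norm_triangle[of r "mat_vec c A z" "mat_vec c B z"] by metis
  also have "\<dots> \<le> cmat_norm r c A * vec_norm c z + cmat_norm r c B * vec_norm c z"
    by (intro add_mono vec_norm_mat_vec_le)
  also have "\<dots> = (cmat_norm r c A + cmat_norm r c B) * vec_norm c z"
    by (rule distrib_right[symmetric])
  finally show "vec_norm r (mat_vec c (\<lambda>i j. A i j + B i j) z) \<le> (cmat_norm r c A + cmat_norm r c B) * vec_norm c z" .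
qed (rule add_nonneg_nonneg[OF cmat_norm_nonneg cmat_norm_nonneg])

lemma cmat_norm_zero [simp]: "cmat_norm r c (\<lambda>i j. 0) = 0"
  using cmat_norm_leI[of 0 r c "\<lambda>i j. 0"] by (simp add: mat_vec_def order_antisym)

lemma cmat_norm_scale: "cmat_norm r c (\<lambda>i j. a * A i j) = cmod a * cmat_norm r c A"
proof -
  have le: "cmat_norm r c (\<lambda>i j. a * A i j) \<le> cmod a * cmat_norm r c A" for a A
  proof (rule cmat_norm_leI)
    fix z :: "nat \<Rightarrow> complex"
    have "mat_vec c (\<lambda>i j. a * A i j) z = (\<lambda>i. a * mat_vec c A z i)"
      by (simp add: mat_vec_def sum_distrib_left mult_ac)
    then show "vec_norm r (mat_vec c (\<lambda>i j. a * A i j) z) \<le> (cmod a * cmat_norm r c A) * vec_norm c z"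
      using vec_norm_mat_vec_le[of r c A z] by (simp add: vec_norm_scale mult.assoc mult_left_mono)
  qed simp
  show ?thesis
  proof (cases "a = 0")
    case False
    have "cmat_norm r c A \<le> cmod (1 / a) * cmat_norm r c (\<lambda>i j. a * A i j)"
      using le[of "1 / a" "\<lambda>i j. a * A i j"] False by simp
    then have "cmod a * cmat_norm r c A \<le> cmat_norm r c (\<lambda>i j. a * A i j)"
      using False by (simp add: norm_divide pos_le_divide_eq mult.commute)
    with le[of a A] show ?thesis by (rule order_antisym)
  qed simp
qed

lemma cmod_le_cmat_norm:
  assumes "i < r" "j < c"
  shows "cmod (A i j) \<le> cmat_norm r c A"
proof -
  have "cmod (mat_vec c A (\<lambda>k. if k = j then 1 else 0) i) \<le> vec_norm r (mat_vec c A (\<lambda>k. if k = j then 1 else 0))"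
    by (rule cmod_le_vec_norm) fact
  also have "\<dots> \<le> cmat_norm r c A"
    by (rule vec_norm_mat_vec_le_unit) (simp add: vec_norm_if_eq assms)
  finally show ?thesis using assms by (simp add: mat_vec_def if_distrib sum.delta cong: if_cong)
qed

lemma cmat_norm_1_1 [simp]: "cmat_norm (Suc 0) (Suc 0) A = cmod (A 0 0)"
  using cmat_norm_le_sum[of "Suc 0" "Suc 0" A] cmod_le_cmat_norm[of 0 "Suc 0" 0 "Suc 0" A] by simp

text \<open>Cauchy-Schwarz. Together with \<open>cmat_norm_col_le\<close> it allows vectors to be
  used as scalar rows and columns in Ruan's axiom \<open>mnorm_bimult\<close>.\<close>

lemma cmat_norm_row_le: "cmat_norm (Suc 0) n A \<le> vec_norm n (A 0)"
  by (rule cmat_norm_leI) (auto simp: mat_vec_def cmod_sum_mult_le)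

lemma cmat_norm_col_le: "cmat_norm n (Suc 0) A \<le> vec_norm n (\<lambda>i. A i 0)"
proof (rule cmat_norm_leI)
  fix z show "vec_norm n (mat_vec (Suc 0) A z) \<le> vec_norm n (\<lambda>i. A i 0) * vec_norm (Suc 0) z"
    by (simp add: mat_vec_def vec_norm_scale mult.commute[of _ "z 0"])
qed simp

lemma cmat_norm_mult_le:
  "cmat_norm r c (\<lambda>i j. \<Sum>k<m. A i k * B k j) \<le> cmat_norm r m A * cmat_norm m c B"
proof (rule cmat_norm_leI)
  fix z
  have "mat_vec c (\<lambda>i j. \<Sum>k<m. A i k * B k j) z = mat_vec m A (mat_vec c B z)"
    unfolding mat_vec_def sum_distrib_left sum_distrib_right
    by (subst sum.swap) (simp add: mult_ac)
  then have "vec_norm r (mat_vec c (\<lambda>i j. \<Sum>k<m. A i k * B k j) z) \<le> cmat_norm r m A * vec_norm m (mat_vec c B z)"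
    by (simp add: vec_norm_mat_vec_le)
  also have "\<dots> \<le> cmat_norm r m A * (cmat_norm m c B * vec_norm c z)"
    by (intro mult_left_mono vec_norm_mat_vec_le) simp
  finally show "vec_norm r (mat_vec c (\<lambda>i j. \<Sum>k<m. A i k * B k j) z) \<le> cmat_norm r m A * cmat_norm m c B * vec_norm c z"
    by (simp add: mult.assoc)
qed simp

text \<open>Permuting rows and columns simultaneously is conjugation by a unitary. One inequality
  for all permutations suffices, since the inverse permutation gives the other.\<close>

lemma cmat_norm_permute:
  assumes \<sigma>: "bij_betw \<sigma> {..<n} {..<n}"
  shows "cmat_norm n n (\<lambda>i j. A (\<sigma> i) (\<sigma> j)) = cmat_norm n n A"
proof -
  have le: "cmat_norm n n (\<lambda>i j. A (\<sigma> i) (\<sigma> j)) \<le> cmat_norm n n A"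
    if \<sigma>: "bij_betw \<sigma> {..<n} {..<n}" for A \<sigma>
  proof (rule cmat_norm_leI)
    fix z :: "nat \<Rightarrow> complex"
    define \<tau> where "\<tau> = inv_into {..<n} \<sigma>"
    have \<tau>: "\<tau> (\<sigma> i) = i" if "i < n" for i
      using that \<sigma> by (simp add: \<tau>_def bij_betw_inv_into_left)
    have vn: "vec_norm n (\<lambda>i. w (\<sigma> i)) = vec_norm n w" for w
      unfolding vec_norm_def L2_set_def using sum.reindex_bij_betw[OF \<sigma>, of "\<lambda>i. (cmod (w i))\<^sup>2"] by simp
    have "mat_vec n (\<lambda>i j. A (\<sigma> i) (\<sigma> j)) z = (\<lambda>i. mat_vec n A (\<lambda>j. z (\<tau> j)) (\<sigma> i))"
      unfolding mat_vec_def
      by (subst sum.reindex_bij_betw[OF \<sigma>, symmetric]) (simp add: \<tau>)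
    moreover have "vec_norm n (\<lambda>j. z (\<tau> j)) = vec_norm n z"
      by (subst vn[symmetric]) (rule vec_norm_cong, simp add: \<tau>)
    ultimately show "vec_norm n (mat_vec n (\<lambda>i j. A (\<sigma> i) (\<sigma> j)) z) \<le> cmat_norm n n A * vec_norm n z"
      using vec_norm_mat_vec_le[of n n A "\<lambda>j. z (\<tau> j)"] by (simp add: vn)
  qed simp
  define \<tau> where "\<tau> = inv_into {..<n} \<sigma>"
  have "bij_betw \<tau> {..<n} {..<n}" unfolding \<tau>_def by (rule bij_betw_inv_into[OF \<sigma>])
  from le[OF this, of "\<lambda>i j. A (\<sigma> i) (\<sigma> j)"]
  have "cmat_norm n n (\<lambda>i j. A (\<sigma> (\<tau> i)) (\<sigma> (\<tau> j))) \<le> cmat_norm n n (\<lambda>i j. A (\<sigma> i) (\<sigma> j))" .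
  moreover have "\<sigma> (\<tau> i) = i" if "i < n" for i
    using that \<sigma> by (simp add: \<tau>_def bij_betw_inv_into_right)
  then have "cmat_norm n n (\<lambda>i j. A (\<sigma> (\<tau> i)) (\<sigma> (\<tau> j))) = cmat_norm n n A"
    by (intro cmat_norm_cong) simp
  ultimately show ?thesis using le[OF \<sigma>, of A] by simp
qed

section \<open>Block structure: index pairs, tensoring with an identity, direct sums\<close>

text \<open>Matches the enumeration of index pairs in \<open>mat_apply\<close>: \<open>k\<close> is
  the outer index \<open>p div m\<close> and \<open>i\<close> the inner index
  \<open>p mod m\<close>.\<close>

lemma sum_lessThan_mult:
  fixes g :: "nat \<Rightarrow> 'b::comm_monoid_add"
  shows "(\<Sum>p<n * m. g p) = (\<Sum>k<n. \<Sum>i<m. g (k * m + i))"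
proof -
  have "(\<Sum>p<n * m. g p) = (\<Sum>k<n. sum g {k * m..<k * m + m})"
    by (rule sum.nat_group[symmetric])
  also have "\<dots> = (\<Sum>k<n. \<Sum>i<m. g (k * m + i))"
    using sum.shift_bounds_nat_ivl[of g 0 "k * m" m for k]
    by (simp add: atLeast0LessThan add.commute)
  finally show ?thesis .
qed

lemma sum_lessThan_add:
  fixes g :: "nat \<Rightarrow> 'b::comm_monoid_add"
  shows "(\<Sum>p<m + n. g p) = (\<Sum>i<m. g i) + (\<Sum>i<n. g (m + i))"
  by (induction n) (simp_all add: add.assoc)

text \<open>The matrix is \<open>\<alpha> \<otimes> I\<^sub>r\<close>, in the enumeration of index pairs used by \<^const>\<open>mat_apply\<close>.\<close>

lemma cmat_norm_tensor_le:
  "cmat_norm (n * r) (m * r) (\<lambda>p q. if p mod r = q mod r then \<alpha> (p div r) (q div r) else 0) \<le> cmat_norm n m \<alpha>"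
proof (rule cmat_norm_leI)
  fix z
  let ?T = "\<lambda>p q. if p mod r = q mod r then \<alpha> (p div r) (q div r) else 0"
  \<comment> \<open>For each inner index \<open>i\<close> the matrix acts as \<alpha> on the vector
    \<open>\<lambda>l. z (l * r + i)\<close>. Squared norms add up over \<open>i\<close>.\<close>
  have mv: "mat_vec (m * r) ?T z (k * r + i) = mat_vec m \<alpha> (\<lambda>l. z (l * r + i)) k" if "i < r" for k i
    using that unfolding mat_vec_def sum_lessThan_mult
    by (intro sum.cong refl) (simp add: if_distrib[where f = "\<lambda>x. x * _"] sum.delta' cong: if_cong)
  have "(vec_norm (n * r) (mat_vec (m * r) ?T z))\<^sup>2
      = (\<Sum>i<r. \<Sum>k<n. (cmod (mat_vec m \<alpha> (\<lambda>l. z (l * r + i)) k))\<^sup>2)"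
    unfolding vec_norm_power2 sum_lessThan_mult by (subst sum.swap) (simp add: mv)
  also have "\<dots> = (\<Sum>i<r. (vec_norm n (mat_vec m \<alpha> (\<lambda>l. z (l * r + i))))\<^sup>2)"
    by (simp add: vec_norm_power2)
  also have "\<dots> \<le> (\<Sum>i<r. (cmat_norm n m \<alpha> * vec_norm m (\<lambda>l. z (l * r + i)))\<^sup>2)"
    by (intro sum_mono power_mono vec_norm_mat_vec_le) simp
  also have "\<dots> = (cmat_norm n m \<alpha>)\<^sup>2 * (\<Sum>i<r. \<Sum>l<m. (cmod (z (l * r + i)))\<^sup>2)"
    by (simp add: power_mult_distrib sum_distrib_left vec_norm_power2)
  also have "\<dots> = (cmat_norm n m \<alpha> * vec_norm (m * r) z)\<^sup>2"
    unfolding power_mult_distrib vec_norm_power2 sum_lessThan_mult by (subst sum.swap) simp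
  finally show "vec_norm (n * r) (mat_vec (m * r) ?T z) \<le> cmat_norm n m \<alpha> * vec_norm (m * r) z"
    by (rule power2_le_imp_le) simp
qed simp

text \<open>The squared norm of a vector is the sum over its two blocks, on which the two summands
  act separately. The lower bounds come from vectors supported in a single block.\<close>

lemma cmat_norm_dsum: "cmat_norm (m + n) (m + n) (mat_dsum m A B) = max (cmat_norm m m A) (cmat_norm n n B)"
proof (rule order_antisym)
  let ?M = "max (cmat_norm m m A) (cmat_norm n n B)"
  have split: "(vec_norm (m + n) z)\<^sup>2 = (vec_norm m z)\<^sup>2 + (vec_norm n (\<lambda>i. z (m + i)))\<^sup>2" for z
    by (simp add: vec_norm_power2 sum_lessThan_add)
  have mv1: "mat_vec (m + n) (mat_dsum m A B) z i = mat_vec m A z i" if "i < m" for i z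
    using that by (simp add: mat_vec_def sum_lessThan_add mat_dsum_def)
  have mv2: "mat_vec (m + n) (mat_dsum m A B) z (m + i) = mat_vec n B (\<lambda>i. z (m + i)) i" for i z
    by (simp add: mat_vec_def sum_lessThan_add mat_dsum_def)
  have mv: "(vec_norm (m + n) (mat_vec (m + n) (mat_dsum m A B) z))\<^sup>2
      = (vec_norm m (mat_vec m A z))\<^sup>2 + (vec_norm n (mat_vec n B (\<lambda>i. z (m + i))))\<^sup>2" for z
    by (simp add: split mv1 mv2 cong: vec_norm_cong)
  show "cmat_norm (m + n) (m + n) (mat_dsum m A B) \<le> ?M"
  proof (rule cmat_norm_leI)
    show "0 \<le> ?M" by (simp add: le_max_iff_disj)
    fix z :: "nat \<Rightarrow> complex"
    have "vec_norm m (mat_vec m A z) \<le> ?M * vec_norm m z"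
      by (rule order_trans[OF vec_norm_mat_vec_le mult_right_mono]) auto
    moreover have "vec_norm n (mat_vec n B (\<lambda>i. z (m + i))) \<le> ?M * vec_norm n (\<lambda>i. z (m + i))"
      by (rule order_trans[OF vec_norm_mat_vec_le mult_right_mono]) auto
    ultimately have "(vec_norm (m + n) (mat_vec (m + n) (mat_dsum m A B) z))\<^sup>2
        \<le> (?M * vec_norm m z)\<^sup>2 + (?M * vec_norm n (\<lambda>i. z (m + i)))\<^sup>2"
      unfolding mv by (intro add_mono power_mono) auto
    also have "\<dots> = (?M * vec_norm (m + n) z)\<^sup>2"
      by (simp only: power_mult_distrib split distrib_left)
    finally show "vec_norm (m + n) (mat_vec (m + n) (mat_dsum m A B) z) \<le> ?M * vec_norm (m + n) z"
      by (rule power2_le_imp_le) (simp add: le_max_iff_disj)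
  qed
  show "?M \<le> cmat_norm (m + n) (m + n) (mat_dsum m A B)"
  proof (rule max.boundedI)
    show "cmat_norm m m A \<le> cmat_norm (m + n) (m + n) (mat_dsum m A B)"
    proof (rule cmat_norm_leI)
      fix z :: "nat \<Rightarrow> complex"
      let ?w = "\<lambda>i. if i < m then z i else 0"
      have "vec_norm m (mat_vec m A z) = vec_norm m (mat_vec m A ?w)"
        by (intro vec_norm_cong) (simp add: mat_vec_def)
      also have "\<dots> \<le> vec_norm (m + n) (mat_vec (m + n) (mat_dsum m A B) ?w)"
        by (rule power2_le_imp_le) (simp_all add: mv)
      also have "\<dots> \<le> cmat_norm (m + n) (m + n) (mat_dsum m A B) * vec_norm (m + n) ?w"
        by (rule vec_norm_mat_vec_le)
      also have "vec_norm (m + n) ?w = vec_norm m z"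
        by (rule power2_eq_imp_eq) (simp_all add: split cong: vec_norm_cong)
      finally show "vec_norm m (mat_vec m A z) \<le> cmat_norm (m + n) (m + n) (mat_dsum m A B) * vec_norm m z" .
    qed simp
    show "cmat_norm n n B \<le> cmat_norm (m + n) (m + n) (mat_dsum m A B)"
    proof (rule cmat_norm_leI)
      fix z :: "nat \<Rightarrow> complex"
      let ?w = "\<lambda>i. if i < m then 0 else z (i - m)"
      have "vec_norm n (mat_vec n B z) = vec_norm n (mat_vec n B (\<lambda>i. ?w (m + i)))"
        by simp
      also have "\<dots> \<le> vec_norm (m + n) (mat_vec (m + n) (mat_dsum m A B) ?w)"
        by (rule power2_le_imp_le) (simp_all add: mv)
      also have "\<dots> \<le> cmat_norm (m + n) (m + n) (mat_dsum m A B) * vec_norm (m + n) ?w"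
        by (rule vec_norm_mat_vec_le)
      also have "vec_norm (m + n) ?w = vec_norm n z"
        by (rule power2_eq_imp_eq) (simp_all add: split cong: vec_norm_cong)
      finally show "vec_norm n (mat_vec n B z) \<le> cmat_norm (m + n) (m + n) (mat_dsum m A B) * vec_norm n z" .
    qed simp
  qed
qed

section \<open>Matrix normed spaces\<close>

text \<open>The axioms of \<^locale>\<open>operator_space\<close> except completeness.\<close>

locale ruan_space =
  fixes V :: "'a::complex_vector opspace"
  assumes subspace_carrier: "csubspace (carrier V)"
    and mnorm_cong: "\<lbrakk>0 < n; X \<in> mats V n; \<And>i j. \<lbrakk>i < n; j < n\<rbrakk> \<Longrightarrow> X i j = Y i j\<rbrakk>
          \<Longrightarrow> mnorm V n X = mnorm V n Y"
    and mnorm_triangle: "\<lbrakk>0 < n; X \<in> mats V n; Y \<in> mats V n\<rbrakk>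
          \<Longrightarrow> mnorm V n (\<lambda>i j. X i j + Y i j) \<le> mnorm V n X + mnorm V n Y"
    and mnorm_scaleC: "\<lbrakk>0 < n; X \<in> mats V n\<rbrakk>
          \<Longrightarrow> mnorm V n (\<lambda>i j. c *\<^sub>C X i j) = cmod c * mnorm V n X"
    and mnorm_eq_0: "\<lbrakk>0 < n; X \<in> mats V n; mnorm V n X = 0; i < n; j < n\<rbrakk> \<Longrightarrow> X i j = 0"
    and mnorm_bimult: "\<lbrakk>0 < m; 0 < n; X \<in> mats V m\<rbrakk>
          \<Longrightarrow> mnorm V n (mat_bimult m \<alpha> X \<beta>) \<le> cmat_norm n m \<alpha> * mnorm V m X * cmat_norm m n \<beta>"
    and mnorm_dsum: "\<lbrakk>0 < m; 0 < n; X \<in> mats V m; Y \<in> mats V n\<rbrakk>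
          \<Longrightarrow> mnorm V (m + n) (mat_dsum m X Y) = max (mnorm V m X) (mnorm V n Y)"

lemma operator_space_iff:
  "operator_space V \<longleftrightarrow> ruan_space V \<and> Metric_space.mcomplete (carrier V) (os_dist V)"
  unfolding operator_space_def ruan_space_def by (simp only: conj_assoc)

lemma matsI: "(\<And>i j. i < n \<Longrightarrow> j < n \<Longrightarrow> X i j \<in> carrier V) \<Longrightarrow> X \<in> mats V n"
  by (simp add: mats_def)

lemma matsD: "X \<in> mats V n \<Longrightarrow> i < n \<Longrightarrow> j < n \<Longrightarrow> X i j \<in> carrier V"
  by (simp add: mats_def)

lemma mat_ballD: "X \<in> mat_ball V n \<Longrightarrow> X \<in> mats V n" "X \<in> mat_ball V n \<Longrightarrow> mnorm V n X < 1"
  by (simp_all add: mat_ball_def)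

lemma unit_ballD: "x \<in> unit_ball V \<Longrightarrow> x \<in> carrier V" "x \<in> unit_ball V \<Longrightarrow> os_norm V x < 1"
  by (simp_all add: unit_ball_def)

context ruan_space
begin

lemma carrier_zero [simp]: "0 \<in> carrier V"
  and carrier_add: "x \<in> carrier V \<Longrightarrow> y \<in> carrier V \<Longrightarrow> x + y \<in> carrier V"
  and carrier_scaleC: "x \<in> carrier V \<Longrightarrow> c *\<^sub>C x \<in> carrier V"
  and carrier_diff: "x \<in> carrier V \<Longrightarrow> y \<in> carrier V \<Longrightarrow> x - y \<in> carrier V"
  and carrier_sum: "(\<And>i. i \<in> I \<Longrightarrow> g i \<in> carrier V) \<Longrightarrow> sum g I \<in> carrier V"
  using complex_vector.subspace_0[OF subspace_carrier]
    complex_vector.subspace_add[OF subspace_carrier]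
    complex_vector.subspace_scale[OF subspace_carrier]
    complex_vector.subspace_diff[OF subspace_carrier]
    complex_vector.subspace_sum[OF subspace_carrier]
  by blast+

lemma mats_const: "x \<in> carrier V \<Longrightarrow> (\<lambda>i j. x) \<in> mats V n"
  by (simp add: mats_def)

lemma mats_bimult: "X \<in> mats V m \<Longrightarrow> mat_bimult m \<alpha> X \<beta> \<in> mats V n"
  unfolding mat_bimult_def by (intro matsI carrier_sum carrier_scaleC) (auto dest: matsD)

lemma mnorm_zero: "0 < n \<Longrightarrow> mnorm V n (\<lambda>i j. 0) = 0"
  using mnorm_scaleC[of n "\<lambda>i j. 0" 0] by (simp add: mats_const)

lemma mnorm_nonneg: "0 < n \<Longrightarrow> X \<in> mats V n \<Longrightarrow> 0 \<le> mnorm V n X"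
  using mnorm_triangle[of n X "\<lambda>i j. (-1) *\<^sub>C X i j"] mnorm_scaleC[of n X "-1"]
  by (simp add: mats_def complex_vector.scale_minus_left carrier_scaleC mnorm_zero
      complex_vector.subspace_neg[OF subspace_carrier])

lemma os_norm_nonneg: "x \<in> carrier V \<Longrightarrow> 0 \<le> os_norm V x"
  by (simp add: os_norm_def mnorm_nonneg mats_const)

lemma os_norm_zero [simp]: "os_norm V 0 = 0"
  by (simp add: os_norm_def mnorm_zero)

lemma os_norm_eq_0: "x \<in> carrier V \<Longrightarrow> os_norm V x = 0 \<Longrightarrow> x = 0"
  using mnorm_eq_0[of 1 "\<lambda>i j. x" 0 0] by (simp add: os_norm_def mats_const)

lemma os_norm_triangle: "x \<in> carrier V \<Longrightarrow> y \<in> carrier V \<Longrightarrow> os_norm V (x + y) \<le> os_norm V x + os_norm V y"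
  using mnorm_triangle[of 1 "\<lambda>i j. x" "\<lambda>i j. y"] by (simp add: os_norm_def mats_const)

lemma os_norm_scaleC: "x \<in> carrier V \<Longrightarrow> os_norm V (c *\<^sub>C x) = cmod c * os_norm V x"
  using mnorm_scaleC[of 1 "\<lambda>i j. x" c] by (simp add: os_norm_def mats_const)

lemma os_norm_minus_commute: "x \<in> carrier V \<Longrightarrow> y \<in> carrier V \<Longrightarrow> os_norm V (x - y) = os_norm V (y - x)"
  using os_norm_scaleC[of "y - x" "-1"] by (simp add: carrier_diff complex_vector.scale_minus_left)

lemma Metric_space: "Metric_space (carrier V) (os_dist V)"
proof
  fix x y z
  show "0 \<le> os_dist V x y"
    by (simp add: os_dist_def os_norm_nonneg carrier_diff)
  show "os_dist V x y = os_dist V y x"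
    by (simp add: os_dist_def os_norm_minus_commute)
  assume x: "x \<in> carrier V" and y: "y \<in> carrier V"
  show "(os_dist V x y = 0) = (x = y)"
    using os_norm_eq_0[of "x - y"] x y by (auto simp: os_dist_def carrier_diff)
  assume z: "z \<in> carrier V"
  show "os_dist V x z \<le> os_dist V x y + os_dist V y z"
    using os_norm_triangle[of "x - y" "y - z"] x y z by (simp add: os_dist_def carrier_diff)
qed

lemma topspace_os_topology [simp]: "topspace (os_topology V) = carrier V"
  unfolding os_topology_def using Metric_space.topspace_mtopology[OF Metric_space] .

lemma os_topology_closure_of:
  "S \<subseteq> carrier V \<Longrightarrow>
    os_topology V closure_of S = {x \<in> carrier V. \<forall>r>0. \<exists>y\<in>S. os_norm V (x - y) < r}"
  unfolding os_topology_def Metric_space.metric_closure_of[OF Metric_space]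
  by (auto simp: Metric_space.in_mball[OF Metric_space] os_dist_def subset_iff)

text \<open>Cauchy sequences and their limits lie in the carrier, so the case distinction in
  \<open>os_dist\<close> disappears and completeness can be stated through \<open>os_norm\<close>
  alone.\<close>

lemma mcomplete_iff:
  "Metric_space.mcomplete (carrier V) (os_dist V) \<longleftrightarrow>
    (\<forall>\<sigma> :: nat \<Rightarrow> 'a. (\<forall>n. \<sigma> n \<in> carrier V) \<and> (\<forall>\<epsilon>>0. \<exists>N. \<forall>m\<ge>N. \<forall>n\<ge>N. os_norm V (\<sigma> m - \<sigma> n) < \<epsilon>) \<longrightarrow>
       (\<exists>x\<in>carrier V. \<forall>\<epsilon>>0. \<exists>N. \<forall>n\<ge>N. os_norm V (\<sigma> n - x) < \<epsilon>))"
proof -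
  interpret Metric_space "carrier V" "os_dist V" by (rule Metric_space)
  have cauchy: "MCauchy \<sigma> \<longleftrightarrow> (\<forall>n. \<sigma> n \<in> carrier V) \<and> (\<forall>\<epsilon>>0. \<exists>N. \<forall>m\<ge>N. \<forall>n\<ge>N. os_norm V (\<sigma> m - \<sigma> n) < \<epsilon>)" for \<sigma>
    unfolding MCauchy_def image_subset_iff os_dist_def by auto
  have lim: "limitin mtopology \<sigma> x sequentially \<longleftrightarrow> x \<in> carrier V \<and> (\<forall>\<epsilon>>0. \<exists>N. \<forall>n\<ge>N. os_norm V (\<sigma> n - x) < \<epsilon>)"
    if "\<forall>n. \<sigma> n \<in> carrier V" for \<sigma> x
    unfolding limit_metric_sequentially os_dist_def using that by auto
  have "(\<exists>x. limitin mtopology \<sigma> x sequentially) \<longleftrightarrow>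
      (\<exists>x\<in>carrier V. \<forall>\<epsilon>>0. \<exists>N. \<forall>n\<ge>N. os_norm V (\<sigma> n - x) < \<epsilon>)" if "MCauchy \<sigma>" for \<sigma>
    using that lim[of \<sigma>] unfolding cauchy Bex_def by simp
  then have "mcomplete \<longleftrightarrow> (\<forall>\<sigma>. MCauchy \<sigma> \<longrightarrow>
      (\<exists>x\<in>carrier V. \<forall>\<epsilon>>0. \<exists>N. \<forall>n\<ge>N. os_norm V (\<sigma> n - x) < \<epsilon>))"
    unfolding mcomplete_def by simp
  then show ?thesis
    unfolding cauchy .
qed

text \<open>Compressing with the \<open>i\<close>-th unit row and the \<open>j\<close>-th unit
  column, both of norm at most 1, extracts the entry as a 1 x 1 matrix, so Ruan's axiom applies. It
  follows that matrices in \<open>mat_ball\<close> have all entries in the domain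
  \<open>unit_ball V\<close>.\<close>

lemma os_norm_le_mnorm:
  assumes "0 < m" "X \<in> mats V m" "i < m" "j < m"
  shows "os_norm V (X i j) \<le> mnorm V m X"
proof -
  define \<alpha> :: "nat \<Rightarrow> nat \<Rightarrow> complex" where "\<alpha> = (\<lambda>_ k. if k = i then 1 else 0)"
  define \<beta> :: "nat \<Rightarrow> nat \<Rightarrow> complex" where "\<beta> = (\<lambda>k _. if k = j then 1 else 0)"
  have "(\<Sum>l<m. (\<alpha> i' k * \<beta> l j') *\<^sub>C X k l) = (if k = i then X i j else 0)" for i' j' k
    using assms by (auto simp: \<alpha>_def \<beta>_def if_distrib[of "\<lambda>c. c *\<^sub>C _"] scaleC_one cong: if_cong)
  then have "mat_bimult m \<alpha> X \<beta> = (\<lambda>_ _. X i j)"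
    using assms by (simp add: mat_bimult_def)
  then have "os_norm V (X i j) \<le> cmat_norm 1 m \<alpha> * mnorm V m X * cmat_norm m 1 \<beta>"
    using mnorm_bimult[of m 1 X \<alpha> \<beta>] assms by (simp add: os_norm_def)
  also have "\<dots> \<le> 1 * mnorm V m X * 1"
    using cmat_norm_row_le[of m \<alpha>] cmat_norm_col_le[of m \<beta>] mnorm_nonneg assms
    by (intro mult_mono) (auto simp: \<alpha>_def \<beta>_def vec_norm_if_eq)
  finally show ?thesis by simp
qed

lemma mat_ball_in_unit_ball:
  "X \<in> mat_ball V m \<Longrightarrow> i < m \<Longrightarrow> j < m \<Longrightarrow> X i j \<in> unit_ball V"
  using os_norm_le_mnorm[of m X i j] by (auto simp: mat_ball_def unit_ball_def matsD)

lemma zero_in_mat_ball: "0 < m \<Longrightarrow> (\<lambda>i j. 0) \<in> mat_ball V m"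
  by (simp add: mat_ball_def mats_const mnorm_zero)

lemma unit_ball_in_mat_ball: "x \<in> unit_ball V \<Longrightarrow> (\<lambda>i j. x) \<in> mat_ball V 1"
  by (simp add: mat_ball_def unit_ball_def mats_const os_norm_def)

end

lemma os_norm_scalar_space [simp]: "os_norm scalar_space z = cmod z"
  by (simp add: os_norm_def scalar_space_def)

lemma carrier_scalar_space [simp]: "carrier scalar_space = UNIV"
  by (simp add: scalar_space_def)

lemma mnorm_scalar_space [simp]: "mnorm scalar_space n = cmat_norm n n"
  by (simp add: scalar_space_def)

section \<open>Functionals and their automatic complete boundedness\<close>

context
  fixes V :: "'a::complex_vector opspace" and \<phi> :: "'a \<Rightarrow> complex"
  assumes lin: "clinear_map V scalar_space \<phi>"
begin

lemma functional_add: "x \<in> carrier V \<Longrightarrow> y \<in> carrier V \<Longrightarrow> \<phi> (x + y) = \<phi> x + \<phi> y"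
  and functional_scaleC: "x \<in> carrier V \<Longrightarrow> \<phi> (c *\<^sub>C x) = c * \<phi> x"
  using lin by (simp_all add: clinear_map_def scaleC_complex_def)

context
  assumes ruan: "ruan_space V"
begin

interpretation ruan_space V by (rule ruan)

lemma functional_diff: "x \<in> carrier V \<Longrightarrow> y \<in> carrier V \<Longrightarrow> \<phi> (x - y) = \<phi> x - \<phi> y"
  using functional_add[of "x - y" y] by (simp add: carrier_diff)

lemma functional_zero: "\<phi> 0 = 0"
  using functional_scaleC[of 0 0] by simp

lemma functional_sum: "(\<And>i. i \<in> I \<Longrightarrow> g i \<in> carrier V) \<Longrightarrow> \<phi> (sum g I) = (\<Sum>i\<in>I. \<phi> (g i))"
proof (induction I rule: infinite_finite_induct)
  case (insert i I)
  then show ?case by (simp add: functional_add carrier_sum)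
qed (simp_all add: functional_zero)

text \<open>Testing the matrix \<open>(\<phi>(x\<^sub>i\<^sub>j))\<close> against vectors \<open>w, z\<close> gives \<open>\<phi>(w\<^sup>* X z)\<close>, to which Ruan's axiom
  for the row \<open>w\<^sup>*\<close> and the column \<open>z\<close> applies.\<close>

lemma functional_completely_bounded:
  assumes C: "0 \<le> C" "\<And>x. x \<in> carrier V \<Longrightarrow> cmod (\<phi> x) \<le> C * os_norm V x"
    and m: "0 < m" and X: "X \<in> mats V m"
  shows "cmat_norm m m (\<lambda>i j. \<phi> (X i j)) \<le> C * mnorm V m X"
proof (rule cmat_norm_leI_unit)
  fix z assume z: "vec_norm m z \<le> 1"
  \<comment> \<open>Testing against the image vector itself makes \<open>\<phi> y\<close> equal to
    \<open>(vec_norm m w)\<^sup>2\<close>; cancelling one factor \<open>vec_norm m w\<close> at the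
    end leaves the bound.\<close>
  define w where "w = mat_vec m (\<lambda>i j. \<phi> (X i j)) z"
  define \<alpha> :: "nat \<Rightarrow> nat \<Rightarrow> complex" where "\<alpha> = (\<lambda>_ k. cnj (w k))"
  define \<beta> :: "nat \<Rightarrow> nat \<Rightarrow> complex" where "\<beta> = (\<lambda>k _. z k)"
  define y where "y = mat_bimult m \<alpha> X \<beta> 0 0"
  have inV: "X k l \<in> carrier V" if "k < m" "l < m" for k l using X that by (rule matsD)
  have y: "y \<in> carrier V"
    using mats_bimult[OF X, of \<alpha> \<beta> 1] by (simp add: y_def matsD)
  have "\<phi> y = (\<Sum>k<m. \<Sum>l<m. (cnj (w k) * z l) * \<phi> (X k l))"
    unfolding y_def mat_bimult_def \<alpha>_def \<beta>_def
    by (subst functional_sum, force intro: carrier_sum carrier_scaleC inV)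
      (intro sum.cong refl, subst functional_sum,
        auto intro!: sum.cong carrier_scaleC inV simp: functional_scaleC inV)
  also have "\<dots> = (\<Sum>k<m. cnj (w k) * w k)"
    by (subst (2) w_def) (simp add: mat_vec_def sum_distrib_left mult_ac)
  also have "\<dots> = of_real ((vec_norm m w)\<^sup>2)"
    unfolding vec_norm_power2 of_real_sum
    by (intro sum.cong refl) (metis complex_norm_square mult.commute of_real_power)
  finally have "cmod (\<phi> y) = (vec_norm m w)\<^sup>2"
    by (simp add: norm_power)
  moreover have "mat_bimult m \<alpha> X \<beta> = (\<lambda>i j. y)"
    by (simp add: y_def mat_bimult_def \<alpha>_def \<beta>_def)
  then have "os_norm V y \<le> cmat_norm 1 m \<alpha> * mnorm V m X * cmat_norm m 1 \<beta>"
    using mnorm_bimult[OF m _ X, of 1 \<alpha> \<beta>] by (simp add: os_norm_def)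
  moreover have "\<dots> \<le> vec_norm m w * mnorm V m X * 1"
    using cmat_norm_row_le[of m \<alpha>] cmat_norm_col_le[of m \<beta>] mnorm_nonneg[OF m X] z
    by (intro mult_mono) (auto simp: \<alpha>_def \<beta>_def vec_norm_def)
  moreover have "cmod (\<phi> y) \<le> C * os_norm V y"
    by (rule C(2)[OF y])
  ultimately have "(vec_norm m w)\<^sup>2 \<le> C * (vec_norm m w * mnorm V m X)"
    using C(1) by (smt (verit) mult_left_mono mult.right_neutral)
  then have "vec_norm m w * vec_norm m w \<le> (C * mnorm V m X) * vec_norm m w"
    by (simp add: power2_eq_square mult_ac)
  then have "vec_norm m w \<le> C * mnorm V m X"
    by (cases "vec_norm m w = 0") (use C(1) mnorm_nonneg[OF m X] in \<open>auto simp: order_less_le\<close>)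
  then show "vec_norm m (mat_vec m (\<lambda>i j. \<phi> (X i j)) z) \<le> C * mnorm V m X"
    by (simp add: w_def)
qed

end

end

lemma bounded_functionalE:
  assumes "bounded_clinear_map V scalar_space \<phi>" "ruan_space V"
  obtains C where "0 \<le> C" "\<And>x. x \<in> carrier V \<Longrightarrow> cmod (\<phi> x) \<le> C * os_norm V x"
proof -
  interpret ruan_space V by fact
  from assms(1) obtain C where "\<forall>x\<in>carrier V. cmod (\<phi> x) \<le> C * os_norm V x"
    by (auto simp: bounded_clinear_map_def)
  \<comment> \<open>The definition of boundedness admits negative constants, hence the maximum with
    0.\<close>
  then have "cmod (\<phi> x) \<le> max 0 C * os_norm V x" if "x \<in> carrier V" for x
    using os_norm_nonneg[OF that] that by (smt (verit) mult_right_mono)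
  then show thesis by (intro that[of "max 0 C"]) auto
qed

section \<open>Spaces of functions with the amplification norms\<close>

lemma sum_fun_apply: "(\<Sum>k\<in>K. f k) x = (\<Sum>k\<in>K. f k x)" for f :: "'k \<Rightarrow> 'a \<Rightarrow> complex"
  by (induction K rule: infinite_finite_induct) auto

lemma scaleC_fun_apply: "(c *\<^sub>C f) x = c * f x" for f :: "'a \<Rightarrow> complex"
  by (simp add: scaleC_fun_def scaleC_complex_def)

lemma cmat_norm_sum_le: "cmat_norm r c (\<lambda>i j. \<Sum>k\<in>K. A k i j) \<le> (\<Sum>k\<in>K. cmat_norm r c (A k))"
proof (induction K rule: infinite_finite_induct)
  case (insert k K)
  have "cmat_norm r c (\<lambda>i j. \<Sum>k\<in>insert k K. A k i j) = cmat_norm r c (\<lambda>i j. A k i j + (\<Sum>k\<in>K. A k i j))"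
    using insert.hyps by simp
  also have "\<dots> \<le> cmat_norm r c (A k) + (\<Sum>k\<in>K. cmat_norm r c (A k))"
    using cmat_norm_triangle[of r c "A k" "\<lambda>i j. \<Sum>k\<in>K. A k i j"] insert.IH by linarith
  finally show ?case using insert.hyps by simp
qed auto

text \<open>By \<open>cmat_norm_le_sum\<close>, the norm of the difference tends to 0 when the
  finitely many entries converge. This carries uniform bounds over to pointwise limits of
  functions.\<close>

lemma cmat_norm_limit_le:
  assumes lim: "\<And>i j. i < r \<Longrightarrow> j < c \<Longrightarrow> (\<lambda>k. A k i j) \<longlonglongrightarrow> B i j"
    and le: "\<forall>\<^sub>F k in sequentially. cmat_norm r c (A k) \<le> M"
  shows "cmat_norm r c B \<le> M"
proof -
  have "(\<lambda>k. M + (\<Sum>i<r. \<Sum>j<c. cmod (B i j - A k i j))) \<longlonglongrightarrow>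
      M + (\<Sum>i<r. \<Sum>j<c. cmod (B i j - B i j))"
    by (intro tendsto_intros lim) auto
  moreover have "\<forall>\<^sub>F k in sequentially. cmat_norm r c B \<le> M + (\<Sum>i<r. \<Sum>j<c. cmod (B i j - A k i j))"
    using le
  proof eventually_elim
    case (elim k)
    have "cmat_norm r c B \<le> cmat_norm r c (A k) + cmat_norm r c (\<lambda>i j. B i j - A k i j)"
      using cmat_norm_triangle[of r c "A k" "\<lambda>i j. B i j - A k i j"] by simp
    with elim cmat_norm_le_sum[of r c "\<lambda>i j. B i j - A k i j"] show ?case by linarith
  qed
  ultimately have "cmat_norm r c B \<le> M + (\<Sum>i<r. \<Sum>j<c. cmod (B i j - B i j))"
    by (rule tendsto_lowerbound) simp
  then show ?thesis by simp
qed

text \<open>Applying \<alpha> F \<beta> to X gives the scalar product of \<alpha> tensor I, F(X) and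
  \<beta> tensor I, where I has size \<open>r\<close>; tensoring with an identity does not increase
  the norm. In the proof \<open>T \<gamma>\<close> is the tensor product of \<gamma> with I.\<close>

lemma cmat_norm_mat_apply_bimult_le:
  fixes F :: "nat \<Rightarrow> nat \<Rightarrow> 'a \<Rightarrow> complex"
  assumes r: "0 < r"
  shows "cmat_norm (n * r) (n * r) (mat_apply r (mat_bimult m \<alpha> F \<beta>) X)
    \<le> cmat_norm n m \<alpha> * cmat_norm (m * r) (m * r) (mat_apply r F X) * cmat_norm m n \<beta>"
proof -
  define T where "T = (\<lambda>(\<gamma> :: nat \<Rightarrow> nat \<Rightarrow> complex) p q. if p mod r = q mod r then \<gamma> (p div r) (q div r) else 0)"
  let ?A = "mat_apply r F X"
  have modr: "p mod r < r" for p using r by simp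
  have T_mult: "(\<Sum>P<m * r. T \<alpha> p P * B P) = (\<Sum>k<m. \<alpha> (p div r) k * B (k * r + p mod r))" for p B
    unfolding sum_lessThan_mult using modr[of p]
    by (intro sum.cong refl) (simp add: T_def if_distrib[where f = "\<lambda>x. x * _"] sum.delta' cong: if_cong)
  have mult_T: "(\<Sum>Q<m * r. B Q * T \<beta> Q q) = (\<Sum>l<m. B (l * r + q mod r) * \<beta> l (q div r))" for q B
    unfolding sum_lessThan_mult using modr[of q]
    by (intro sum.cong refl) (simp add: T_def if_distrib[where f = "\<lambda>x. _ * x"] sum.delta cong: if_cong)
  have "mat_apply r (mat_bimult m \<alpha> F \<beta>) X p q
      = (\<Sum>Q<m * r. (\<Sum>P<m * r. T \<alpha> p P * ?A P Q) * T \<beta> Q q)" for p q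
  proof -
    have "(\<Sum>Q<m * r. (\<Sum>P<m * r. T \<alpha> p P * ?A P Q) * T \<beta> Q q)
        = (\<Sum>l<m. (\<Sum>k<m. \<alpha> (p div r) k * ?A (k * r + p mod r) (l * r + q mod r)) * \<beta> l (q div r))"
      unfolding mult_T T_mult ..
    also have "\<dots> = (\<Sum>k<m. \<Sum>l<m. \<alpha> (p div r) k * \<beta> l (q div r) * F k l (X (p mod r) (q mod r)))"
      unfolding sum_distrib_right
      by (subst sum.swap) (intro sum.cong refl, use r in \<open>simp add: mat_apply_def mult.assoc mult.left_commute\<close>)
    finally show ?thesis
      by (simp add: mat_apply_def mat_bimult_def sum_fun_apply scaleC_fun_def scaleC_complex_def)
  qed
  then have "cmat_norm (n * r) (n * r) (mat_apply r (mat_bimult m \<alpha> F \<beta>) X)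
      = cmat_norm (n * r) (n * r) (\<lambda>p q. \<Sum>Q<m * r. (\<Sum>P<m * r. T \<alpha> p P * ?A P Q) * T \<beta> Q q)"
    by (intro cmat_norm_cong) simp
  also have "\<dots> \<le> cmat_norm (n * r) (m * r) (\<lambda>p Q. \<Sum>P<m * r. T \<alpha> p P * ?A P Q) * cmat_norm (m * r) (n * r) (T \<beta>)"
    by (rule cmat_norm_mult_le)
  also have "\<dots> \<le> (cmat_norm (n * r) (m * r) (T \<alpha>) * cmat_norm (m * r) (m * r) ?A) * cmat_norm (m * r) (n * r) (T \<beta>)"
    by (intro mult_right_mono cmat_norm_mult_le) simp
  also have "\<dots> \<le> (cmat_norm n m \<alpha> * cmat_norm (m * r) (m * r) ?A) * cmat_norm m n \<beta>"
    unfolding T_def by (intro mult_mono cmat_norm_tensor_le mult_nonneg_nonneg) simp_all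
  finally show ?thesis .
qed

lemma cmat_norm_mat_apply_1:
  "cmat_norm (1 * m) (1 * m) (mat_apply m (\<lambda>_ _. f) X) = cmat_norm m m (\<lambda>i j. f (X i j))"
proof -
  have "cmat_norm m m (\<lambda>p q. f (X (p mod m) (q mod m))) = cmat_norm m m (\<lambda>i j. f (X i j))"
    by (rule cmat_norm_cong) simp
  then show ?thesis by (simp add: mat_apply_def)
qed

text \<open>F is the sum of its single-entry matrices. Each of these is a 1 x 1 matrix multiplied by
  a unit column and a unit row, to which \<open>cmat_norm_mat_apply_bimult_le\<close>
  applies.\<close>

lemma cmat_norm_mat_apply_le_sum:
  fixes F :: "nat \<Rightarrow> nat \<Rightarrow> 'a \<Rightarrow> complex"
  assumes m: "0 < m"
  shows "cmat_norm (n * m) (n * m) (mat_apply m F X)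
    \<le> (\<Sum>k<n. \<Sum>l<n. cmat_norm m m (\<lambda>i j. F k l (X i j)))"
proof -
  define \<alpha> :: "nat \<Rightarrow> nat \<Rightarrow> nat \<Rightarrow> complex" where "\<alpha> = (\<lambda>k i _. if i = k then 1 else 0)"
  define \<beta> :: "nat \<Rightarrow> nat \<Rightarrow> nat \<Rightarrow> complex" where "\<beta> = (\<lambda>l _ j. if j = l then 1 else 0)"
  let ?G = "\<lambda>k l. mat_bimult 1 (\<alpha> k) (\<lambda>_ _. F k l) (\<beta> l)"
  have \<alpha>: "cmat_norm n 1 (\<alpha> k) \<le> 1" if "k < n" for k
    using cmat_norm_col_le[of n "\<alpha> k"] vec_norm_if_eq[OF that] by (simp add: \<alpha>_def)
  have \<beta>: "cmat_norm 1 n (\<beta> l) \<le> 1" if "l < n" for l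
    using cmat_norm_row_le[of n "\<beta> l"] vec_norm_if_eq[OF that] by (simp add: \<beta>_def)
  have G: "mat_apply m (?G k l) X p q
      = (if l = q div m then if k = p div m then mat_apply m F X p q else 0 else 0)" for k l p q
    by (simp add: mat_apply_def mat_bimult_def \<alpha>_def \<beta>_def scaleC_fun_def scaleC_complex_def)
  have "cmat_norm (n * m) (n * m) (mat_apply m F X)
      = cmat_norm (n * m) (n * m) (\<lambda>p q. \<Sum>k<n. \<Sum>l<n. mat_apply m (?G k l) X p q)"
    unfolding G by (intro cmat_norm_cong) (simp add: less_mult_imp_div_less sum.delta)
  also have "\<dots> \<le> (\<Sum>k<n. \<Sum>l<n. cmat_norm (n * m) (n * m) (mat_apply m (?G k l) X))"
    by (rule order_trans[OF cmat_norm_sum_le]) (intro sum_mono cmat_norm_sum_le)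
  also have "\<dots> \<le> (\<Sum>k<n. \<Sum>l<n. cmat_norm m m (\<lambda>i j. F k l (X i j)))"
  proof (intro sum_mono)
    fix k l assume "k \<in> {..<n}" "l \<in> {..<n}"
    then have kl: "k < n" "l < n" by auto
    have "cmat_norm (n * m) (n * m) (mat_apply m (?G k l) X)
        \<le> cmat_norm n 1 (\<alpha> k) * cmat_norm (1 * m) (1 * m) (mat_apply m (\<lambda>_ _. F k l) X) * cmat_norm 1 n (\<beta> l)"
      by (rule cmat_norm_mat_apply_bimult_le[OF m])
    also have "\<dots> \<le> 1 * cmat_norm (1 * m) (1 * m) (mat_apply m (\<lambda>_ _. F k l) X) * 1"
      by (intro mult_mono \<alpha> \<beta> kl) simp_all
    also have "\<dots> = cmat_norm m m (\<lambda>i j. F k l (X i j))"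
      unfolding cmat_norm_mat_apply_1 by simp
    finally show "cmat_norm (n * m) (n * m) (mat_apply m (?G k l) X) \<le> cmat_norm m m (\<lambda>i j. F k l (X i j))" .
  qed
  finally show ?thesis .
qed

section \<open>Ruan's axioms and completeness for amplification norms\<close>

lemma amp_values_scalar:
  "amp_values V scalar_space n F
    = {cmat_norm (n * m) (n * m) (mat_apply m F X) | m X. 0 < m \<and> X \<in> mat_ball V m}"
  by (simp add: amp_values_def)

text \<open>Common frame for \<open>dual_space V\<close> and \<open>Hcb V scalar_space\<close>. The
  assumption \<open>eq_0\<close> makes the norm definite: functionals satisfy it by homogeneity,
  functions on the ball because they are extended by zero.\<close>

locale amp_space = ruan_space V for V :: "'a::complex_vector opspace" +
  fixes S :: "('a \<Rightarrow> complex) set"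
  assumes subspace: "csubspace S"
    and amp_bdd: "f \<in> S \<Longrightarrow> bdd_above (amp_values V scalar_space 1 (\<lambda>k l. f))"
    and eq_0: "f \<in> S \<Longrightarrow> (\<And>x. x \<in> unit_ball V \<Longrightarrow> f x = 0) \<Longrightarrow> f = 0"
begin

definition "fspace = \<lparr>carrier = S, mnorm = amp_norm V scalar_space\<rparr>"

lemma carrier_fspace [simp]: "carrier fspace = S"
  and mnorm_fspace [simp]: "mnorm fspace = amp_norm V scalar_space"
  by (simp_all add: fspace_def)

text \<open>\<open>amp_bdd\<close> covers only single functions; the sum bound over the entries
  extends it to all matrix sizes, so that \<open>amp_norm\<close> is a genuine supremum.\<close>

lemma amp_values_bdd:
  assumes "F \<in> mats fspace n"
  shows "bdd_above (amp_values V scalar_space n F)"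
proof -
  have "\<exists>B. \<forall>m X. 0 < m \<longrightarrow> X \<in> mat_ball V m \<longrightarrow> cmat_norm m m (\<lambda>i j. f (X i j)) \<le> B" if "f \<in> S" for f
    using amp_bdd[OF that] unfolding bdd_above_def amp_values_scalar cmat_norm_mat_apply_1 by blast
  then obtain B where B: "cmat_norm m m (\<lambda>i j. f (X i j)) \<le> B f" if "f \<in> S" "0 < m" "X \<in> mat_ball V m" for f m X
    by metis
  have "cmat_norm (n * m) (n * m) (mat_apply m F X) \<le> (\<Sum>k<n. \<Sum>l<n. B (F k l))"
    if "0 < m" "X \<in> mat_ball V m" for m X
    using that assms
    by (intro order_trans[OF cmat_norm_mat_apply_le_sum] sum_mono B) (auto dest: matsD)
  then show ?thesis
    unfolding amp_values_scalar by (auto intro!: bdd_aboveI)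
qed

lemma cmat_norm_le_amp_norm:
  "F \<in> mats fspace n \<Longrightarrow> 0 < m \<Longrightarrow> X \<in> mat_ball V m \<Longrightarrow>
    cmat_norm (n * m) (n * m) (mat_apply m F X) \<le> amp_norm V scalar_space n F"
  unfolding amp_norm_def by (rule cSup_upper[OF _ amp_values_bdd]) (auto simp: amp_values_scalar)

lemma amp_norm_leI:
  "(\<And>m X. 0 < m \<Longrightarrow> X \<in> mat_ball V m \<Longrightarrow> cmat_norm (n * m) (n * m) (mat_apply m F X) \<le> K) \<Longrightarrow>
    amp_norm V scalar_space n F \<le> K"
  unfolding amp_norm_def amp_values_scalar
  by (rule cSup_least) (auto intro: exI[of _ 1] zero_in_mat_ball)

lemma os_norm_leI:
  "(\<And>m X. 0 < m \<Longrightarrow> X \<in> mat_ball V m \<Longrightarrow> cmat_norm m m (\<lambda>i j. f (X i j)) \<le> K) \<Longrightarrow>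
    os_norm fspace f \<le> K"
  unfolding os_norm_def mnorm_fspace by (rule amp_norm_leI) (simp add: cmat_norm_mat_apply_1[simplified])

lemma cmat_norm_le_os_norm:
  "f \<in> S \<Longrightarrow> 0 < m \<Longrightarrow> X \<in> mat_ball V m \<Longrightarrow> cmat_norm m m (\<lambda>i j. f (X i j)) \<le> os_norm fspace f"
  using cmat_norm_le_amp_norm[of "\<lambda>_ _. f" 1 m X]
  by (simp add: os_norm_def mats_def cmat_norm_mat_apply_1[simplified])

lemma cmod_le_os_norm: "f \<in> S \<Longrightarrow> x \<in> unit_ball V \<Longrightarrow> cmod (f x) \<le> os_norm fspace f"
  using cmat_norm_le_os_norm[of f 1 "\<lambda>_ _. x"] unit_ball_in_mat_ball[of x] by simp

text \<open>Each axiom holds for the scalar matrices obtained from one test matrix X, by the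
  corresponding fact on \<open>cmat_norm\<close>, and survives the supremum over X.\<close>

lemma ruan_space_fspace: "ruan_space fspace"
proof
  show "csubspace (carrier fspace)" by (simp add: subspace)
next
  fix n :: nat and F G :: "nat \<Rightarrow> nat \<Rightarrow> 'a \<Rightarrow> complex"
  assume n: "0 < n" and F: "F \<in> mats fspace n"
  show "mnorm fspace n F = mnorm fspace n G" if "\<And>i j. i < n \<Longrightarrow> j < n \<Longrightarrow> F i j = G i j"
  proof -
    have "cmat_norm (n * m) (n * m) (mat_apply m F X) = cmat_norm (n * m) (n * m) (mat_apply m G X)" for m X
      by (rule cmat_norm_cong) (simp add: mat_apply_def that less_mult_imp_div_less)
    then show ?thesis by (simp add: amp_norm_def amp_values_scalar)
  qed
  show "mnorm fspace n (\<lambda>i j. F i j + G i j) \<le> mnorm fspace n F + mnorm fspace n G" if G: "G \<in> mats fspace n"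
    unfolding mnorm_fspace
  proof (rule amp_norm_leI)
    fix m X assume mX: "0 < m" "X \<in> mat_ball V m"
    have "mat_apply m (\<lambda>i j. F i j + G i j) X = (\<lambda>p q. mat_apply m F X p q + mat_apply m G X p q)"
      by (simp add: mat_apply_def)
    then show "cmat_norm (n * m) (n * m) (mat_apply m (\<lambda>i j. F i j + G i j) X)
        \<le> amp_norm V scalar_space n F + amp_norm V scalar_space n G"
      using cmat_norm_triangle[of "n * m" "n * m" "mat_apply m F X" "mat_apply m G X"]
        cmat_norm_le_amp_norm[OF F mX] cmat_norm_le_amp_norm[OF G mX] by simp
  qed
  show scale: "mnorm fspace n (\<lambda>i j. c *\<^sub>C F i j) = cmod c * mnorm fspace n F" for c
  proof -
    have eq: "mat_apply m (\<lambda>i j. c *\<^sub>C F i j) X = (\<lambda>p q. c * mat_apply m F X p q)" for c F and m and X :: "nat \<Rightarrow> nat \<Rightarrow> 'a"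
      by (simp add: mat_apply_def scaleC_fun_def scaleC_complex_def)
    have le: "amp_norm V scalar_space n (\<lambda>i j. c *\<^sub>C F i j) \<le> cmod c * amp_norm V scalar_space n F"
      if "F \<in> mats fspace n" for c F
      by (rule amp_norm_leI) (simp add: eq cmat_norm_scale mult_left_mono cmat_norm_le_amp_norm[OF that])
    show ?thesis
    proof (cases "c = 0")
      case True
      have "0 \<le> amp_norm V scalar_space n (\<lambda>i j. 0 *\<^sub>C F i j)"
        using cmat_norm_le_amp_norm[of "\<lambda>i j. 0 *\<^sub>C F i j" n 1 "\<lambda>_ _. 0"] zero_in_mat_ball[of 1]
          complex_vector.subspace_0[OF subspace]
        by (force simp: mats_def intro: order_trans[OF cmat_norm_nonneg])
      with le[OF F, of 0] True show ?thesis by simp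
    next
      case False
      have "(\<lambda>i j. c *\<^sub>C F i j) \<in> mats fspace n"
        using F complex_vector.subspace_scale[OF subspace] by (simp add: mats_def)
      from le[OF this, of "1 / c"] False
      have "amp_norm V scalar_space n F \<le> cmod (1 / c) * amp_norm V scalar_space n (\<lambda>i j. c *\<^sub>C F i j)"
        by (simp add: scaleC_scaleC scaleC_one)
      then have "cmod c * amp_norm V scalar_space n F \<le> amp_norm V scalar_space n (\<lambda>i j. c *\<^sub>C F i j)"
        using False by (simp add: norm_divide pos_le_divide_eq mult.commute)
      with le[OF F, of c] show ?thesis by simp
    qed
  qed
  show "F i j = 0" if 0: "mnorm fspace n F = 0" and ij: "i < n" "j < n" for i j
  proof (rule eq_0)
    show "F i j \<in> S" using F ij by (auto dest: matsD)
    fix x assume "x \<in> unit_ball V"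
    then have "cmat_norm (n * 1) (n * 1) (mat_apply 1 F (\<lambda>_ _. x)) \<le> 0"
      using cmat_norm_le_amp_norm[OF F _ unit_ball_in_mat_ball] 0 by (metis mnorm_fspace zero_less_one)
    then have "cmod (mat_apply 1 F (\<lambda>_ _. x) i j) \<le> 0"
      using cmod_le_cmat_norm[of i "n * 1" j "n * 1"] ij by (metis mult.right_neutral order_trans)
    then show "F i j x = 0" by (simp add: mat_apply_def)
  qed
  show "mnorm fspace m (mat_bimult n \<alpha> F \<beta>) \<le> cmat_norm m n \<alpha> * mnorm fspace n F * cmat_norm n m \<beta>"
    if "0 < m" for m \<alpha> \<beta>
    unfolding mnorm_fspace
  proof (rule amp_norm_leI)
    fix r X assume rX: "0 < r" "X \<in> mat_ball V r"
    show "cmat_norm (m * r) (m * r) (mat_apply r (mat_bimult n \<alpha> F \<beta>) X)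
        \<le> cmat_norm m n \<alpha> * amp_norm V scalar_space n F * cmat_norm n m \<beta>"
      by (rule order_trans[OF cmat_norm_mat_apply_bimult_le[OF rX(1)]])
        (intro mult_right_mono mult_left_mono cmat_norm_le_amp_norm F rX cmat_norm_nonneg)
  qed
next
  fix m n :: nat and F G :: "nat \<Rightarrow> nat \<Rightarrow> 'a \<Rightarrow> complex"
  assume mn: "0 < m" "0 < n" and F: "F \<in> mats fspace m" and G: "G \<in> mats fspace n"
  have FG: "mat_dsum m F G \<in> mats fspace (m + n)"
    using F G complex_vector.subspace_0[OF subspace] by (auto simp: mats_def mat_dsum_def)
  \<comment> \<open>As the outer index is the leading one in the enumeration of pairs, a direct sum
    of function matrices becomes a scalar direct sum, split at \<open>m * r\<close>.\<close>
  have eq: "cmat_norm ((m + n) * r) ((m + n) * r) (mat_apply r (mat_dsum m F G) X)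
      = max (cmat_norm (m * r) (m * r) (mat_apply r F X)) (cmat_norm (n * r) (n * r) (mat_apply r G X))"
    if r: "0 < r" for r and X :: "nat \<Rightarrow> nat \<Rightarrow> 'a"
  proof -
    have le: "m \<le> p div r \<longleftrightarrow> m * r \<le> p" for p
      by (simp only: not_less[symmetric] div_less_iff_less_mult[OF r])
    have sub: "(p - m * r) div r = p div r - m" "(p - m * r) mod r = p mod r" if "m * r \<le> p" for p
    proof -
      obtain q where "p = m * r + q" using le_Suc_ex[OF \<open>m * r \<le> p\<close>] by blast
      then show "(p - m * r) div r = p div r - m" "(p - m * r) mod r = p mod r" using r by simp_all
    qed
    have "mat_apply r (mat_dsum m F G) X = mat_dsum (m * r) (mat_apply r F X) (mat_apply r G X)"
      by (simp add: fun_eq_iff mat_apply_def mat_dsum_def le sub not_le[symmetric])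
    then show ?thesis by (simp add: distrib_right cmat_norm_dsum)
  qed
  show "mnorm fspace (m + n) (mat_dsum m F G) = max (mnorm fspace m F) (mnorm fspace n G)"
  proof (rule order_antisym)
    show "mnorm fspace (m + n) (mat_dsum m F G) \<le> max (mnorm fspace m F) (mnorm fspace n G)"
      unfolding mnorm_fspace
    proof (rule amp_norm_leI)
      fix r X assume rX: "0 < r" "X \<in> mat_ball V r"
      show "cmat_norm ((m + n) * r) ((m + n) * r) (mat_apply r (mat_dsum m F G) X)
          \<le> max (amp_norm V scalar_space m F) (amp_norm V scalar_space n G)"
        unfolding eq[OF rX(1)]
        by (intro max.mono cmat_norm_le_amp_norm F G rX)
    qed
    show "max (mnorm fspace m F) (mnorm fspace n G) \<le> mnorm fspace (m + n) (mat_dsum m F G)"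
      unfolding mnorm_fspace
    proof (rule max.boundedI; rule amp_norm_leI)
      fix r X assume rX: "0 < r" "X \<in> mat_ball V r"
      note * = cmat_norm_le_amp_norm[OF FG rX, unfolded eq[OF rX(1)]]
      show "cmat_norm (m * r) (m * r) (mat_apply r F X) \<le> amp_norm V scalar_space (m + n) (mat_dsum m F G)"
        using * by simp
      show "cmat_norm (n * r) (n * r) (mat_apply r G X) \<le> amp_norm V scalar_space (m + n) (mat_dsum m F G)"
        using * by simp
    qed
  qed
qed

text \<open>Reduces completeness to one closure property of \<open>S\<close>: norm-bounded sequences
  that are uniformly Cauchy on the ball have their pointwise limit in \<open>S\<close>. Convergence
  in the amplification norm then comes for free.\<close>

lemma operator_space_fspace:
  assumes closed: "\<And>f M. \<lbrakk>\<And>n. f n \<in> S; \<And>n. os_norm fspace (f n) \<le> M;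
      \<And>\<epsilon>. 0 < \<epsilon> \<Longrightarrow> \<exists>N. \<forall>m\<ge>N. \<forall>n\<ge>N. \<forall>x\<in>unit_ball V. cmod (f m x - f n x) \<le> \<epsilon>\<rbrakk>
      \<Longrightarrow> \<exists>g\<in>S. \<forall>x\<in>unit_ball V. (\<lambda>n. f n x) \<longlonglongrightarrow> g x"
  shows "operator_space fspace"
  unfolding operator_space_iff
proof (intro conjI ruan_space_fspace)
  interpret sp: ruan_space fspace by (rule ruan_space_fspace)
  show "Metric_space.mcomplete (carrier fspace) (os_dist fspace)"
    unfolding sp.mcomplete_iff unfolding carrier_fspace
  proof (intro allI impI, elim conjE)
    fix \<sigma> :: "nat \<Rightarrow> 'a \<Rightarrow> complex"
    assume \<sigma>: "\<forall>n. \<sigma> n \<in> S"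
      and cauchy: "\<forall>\<epsilon>>0. \<exists>N. \<forall>m\<ge>N. \<forall>n\<ge>N. os_norm fspace (\<sigma> m - \<sigma> n) < \<epsilon>"
    obtain N where N: "os_norm fspace (\<sigma> m - \<sigma> n) < 1" if "m \<ge> N" "n \<ge> N" for m n
      using cauchy by (meson zero_less_one)
    \<comment> \<open>In this tail every norm is at most
      \<open>os_norm fspace (\<sigma> N) + 1\<close>, so \<open>closed\<close> receives a bound
      valid for all indices.\<close>
    define f where "f n = \<sigma> (n + N)" for n
    have fS: "f n \<in> S" for n using \<sigma> by (simp add: f_def)
    have bound: "os_norm fspace (f n) \<le> os_norm fspace (\<sigma> N) + 1" for n
      using sp.os_norm_triangle[of "f n - \<sigma> N" "\<sigma> N"] N[of "n + N" N] \<sigma> sp.carrier_diff[of "f n" "\<sigma> N"] fS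
      by (simp add: f_def)
    have cauchy_f: "\<exists>K. \<forall>m\<ge>K. \<forall>n\<ge>K. os_norm fspace (f m - f n) < \<epsilon>" if "0 < \<epsilon>" for \<epsilon>
      using cauchy that unfolding f_def by (meson trans_le_add1)
    have "\<exists>K. \<forall>m\<ge>K. \<forall>n\<ge>K. \<forall>x\<in>unit_ball V. cmod (f m x - f n x) \<le> \<epsilon>" if "0 < \<epsilon>" for \<epsilon>
    proof -
      obtain K where K: "os_norm fspace (f m - f n) < \<epsilon>" if "m \<ge> K" "n \<ge> K" for m n
        using cauchy_f[OF \<open>0 < \<epsilon>\<close>] by blast
      have "cmod (f m x - f n x) \<le> \<epsilon>" if "m \<ge> K" "n \<ge> K" "x \<in> unit_ball V" for m n x
        using cmod_le_os_norm[of "f m - f n" x] K[of m n] that sp.carrier_diff[of "f m" "f n"] fS by simp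
      then show ?thesis by blast
    qed
    from closed[OF fS bound this] obtain g where g: "g \<in> S"
      and lim: "\<And>x. x \<in> unit_ball V \<Longrightarrow> (\<lambda>n. f n x) \<longlonglongrightarrow> g x" by blast
    show "\<exists>x\<in>S. \<forall>\<epsilon>>0. \<exists>N. \<forall>n\<ge>N. os_norm fspace (\<sigma> n - x) < \<epsilon>"
    proof (intro bexI[OF _ g] allI impI)
      fix \<epsilon> :: real assume \<epsilon>: "0 < \<epsilon>"
      obtain K where K: "os_norm fspace (f m - f n) < \<epsilon> / 2" if "m \<ge> K" "n \<ge> K" for m n
        using cauchy_f[of "\<epsilon> / 2"] \<epsilon> by auto
      \<comment> \<open>The second index goes to infinity for a fixed test matrix; \<open>K\<close>
        does not depend on that matrix, so the supremum may be taken afterwards.\<close>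
      have "os_norm fspace (f n - g) \<le> \<epsilon> / 2" if n: "n \<ge> K" for n
      proof (rule os_norm_leI)
        fix m X assume mX: "0 < m" "X \<in> mat_ball V m"
        show "cmat_norm m m (\<lambda>i j. (f n - g) (X i j)) \<le> \<epsilon> / 2"
        proof (rule cmat_norm_limit_le)
          show "(\<lambda>k. (f n - f k) (X i j)) \<longlonglongrightarrow> (f n - g) (X i j)" if "i < m" "j < m" for i j
            using mat_ball_in_unit_ball[OF mX(2) that] by (auto intro!: tendsto_intros lim)
          show "\<forall>\<^sub>F k in sequentially. cmat_norm m m (\<lambda>i j. (f n - f k) (X i j)) \<le> \<epsilon> / 2"
          proof (rule eventually_sequentiallyI[of K])
            fix k assume k: "K \<le> k"
            have "cmat_norm m m (\<lambda>i j. (f n - f k) (X i j)) \<le> os_norm fspace (f n - f k)"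
              by (rule cmat_norm_le_os_norm[of "f n - f k", OF _ mX]) (use sp.carrier_diff[of "f n" "f k"] fS in simp)
            with K[OF n k] show "cmat_norm m m (\<lambda>i j. (f n - f k) (X i j)) \<le> \<epsilon> / 2" by linarith
          qed
        qed
      qed
      then have le: "os_norm fspace (f n - g) \<le> \<epsilon> / 2" if "n \<ge> K" for n
        using that .
      have "os_norm fspace (\<sigma> n - g) < \<epsilon>" if "n \<ge> K + N" for n
      proof -
        have "K \<le> n - N" "n - N + N = n" using that by simp_all
        with le[of "n - N"] \<epsilon> show ?thesis by (simp add: f_def)
      qed
      then show "\<exists>N. \<forall>n\<ge>N. os_norm fspace (\<sigma> n - g) < \<epsilon>" by blast
    qed
  qed
qed

end

section \<open>Duals and subspaces\<close>

text \<open>Unit balls are open, so an element can only be normalised by some \<open>s\<close>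
  strictly above its norm. Letting \<open>s\<close> decrease to \<open>a\<close> removes the
  slack.\<close>

lemma le_mult_of_greater:
  fixes a c M :: real
  assumes "0 \<le> M" "\<And>s. a < s \<Longrightarrow> c \<le> M * s"
  shows "c \<le> M * a"
proof (rule tendsto_lowerbound)
  show "((\<lambda>s. M * s) \<longlongrightarrow> M * a) (at_right a)" by (intro tendsto_intros)
  show "\<forall>\<^sub>F s in at_right a. c \<le> M * s"
    using assms(2) by (auto simp: eventually_at_right_field intro: exI[of _ "a + 1"])
qed simp

lemma dual_carrier_iff:
  assumes "ruan_space V"
  shows "\<phi> \<in> carrier (dual_space V) \<longleftrightarrow>
    (\<forall>x\<in>carrier V. \<forall>y\<in>carrier V. \<phi> (x + y) = \<phi> x + \<phi> y) \<and>
    (\<forall>c. \<forall>x\<in>carrier V. \<phi> (c *\<^sub>C x) = c * \<phi> x) \<and>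
    (\<exists>C\<ge>0. \<forall>x\<in>carrier V. cmod (\<phi> x) \<le> C * os_norm V x) \<and> (\<forall>x. x \<notin> carrier V \<longrightarrow> \<phi> x = 0)"
proof -
  have "\<exists>C\<ge>0. \<forall>x\<in>carrier V. cmod (\<phi> x) \<le> C * os_norm V x" if "bounded_clinear_map V scalar_space \<phi>"
    using bounded_functionalE[OF that assms] by metis
  then show ?thesis
    by (auto simp: dual_space_def bounded_clinear_map_def clinear_map_def scaleC_complex_def)
qed

lemma dual_clinear: "\<phi> \<in> carrier (dual_space V) \<Longrightarrow> clinear_map V scalar_space \<phi>"
  by (simp add: dual_space_def bounded_clinear_map_def)

context ruan_space
begin

lemma scale_into_unit_ball:
  assumes "x \<in> carrier V" "os_norm V x < s"
  shows "of_real (1 / s) *\<^sub>C x \<in> unit_ball V" "of_real s *\<^sub>C of_real (1 / s) *\<^sub>C x = x"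
proof -
  have s: "0 < s" using os_norm_nonneg assms by (meson le_less_trans)
  with assms show "of_real (1 / s) *\<^sub>C x \<in> unit_ball V"
    by (simp add: unit_ball_def carrier_scaleC os_norm_scaleC norm_divide)
  from s show "of_real s *\<^sub>C of_real (1 / s) *\<^sub>C x = x"
    by (simp add: scaleC_scaleC scaleC_one)
qed

lemma functional_bound_of_ball:
  assumes lin: "clinear_map V scalar_space \<phi>" and M: "\<And>x. x \<in> unit_ball V \<Longrightarrow> cmod (\<phi> x) \<le> M"
    and x: "x \<in> carrier V"
  shows "cmod (\<phi> x) \<le> M * os_norm V x"
proof (rule le_mult_of_greater)
  have "0 \<in> unit_ball V" by (simp add: unit_ball_def)
  from M[OF this] show "0 \<le> M" by (meson norm_ge_zero order_trans)
  fix s assume s: "os_norm V x < s"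
  then have "0 < s" using os_norm_nonneg x by (meson le_less_trans)
  have "cmod (\<phi> x) = cmod (of_real s * \<phi> (of_real (1 / s) *\<^sub>C x))"
    using functional_scaleC[OF lin, of "of_real (1 / s) *\<^sub>C x" "of_real s"] scale_into_unit_ball[OF x s]
    by (simp add: unit_ball_def)
  also have "\<dots> = s * cmod (\<phi> (of_real (1 / s) *\<^sub>C x))"
    using \<open>0 < s\<close> by (simp add: norm_mult)
  also have "\<dots> \<le> s * M"
    using \<open>0 < s\<close> M[OF scale_into_unit_ball(1)[OF x s]] by simp
  finally show "cmod (\<phi> x) \<le> M * s" by (simp add: mult.commute)
qed

text \<open>The carrier of the dual is defined by plain boundedness. That \<open>amp_bdd\<close>
  holds rests on \<open>functional_completely_bounded\<close>, which bounds all amplifications by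
  the same constant.\<close>

lemma amp_space_dual: "amp_space V (carrier (dual_space V))"
proof
  note iff = dual_carrier_iff[OF ruan_space_axioms]
  show "csubspace (carrier (dual_space V))"
  proof (rule complex_vector.subspaceI)
    show "0 \<in> carrier (dual_space V)"
      unfolding iff by (auto intro: exI[of _ 0])
    fix \<phi> \<psi> assume "\<phi> \<in> carrier (dual_space V)" "\<psi> \<in> carrier (dual_space V)"
    moreover from this obtain C D where CD: "0 \<le> C" "0 \<le> D"
      "\<forall>x\<in>carrier V. cmod (\<phi> x) \<le> C * os_norm V x" "\<forall>x\<in>carrier V. cmod (\<psi> x) \<le> D * os_norm V x"
      unfolding iff by blast
    then have "cmod (\<phi> x + \<psi> x) \<le> (C + D) * os_norm V x" if "x \<in> carrier V" for x
      unfolding distrib_right using that by (meson add_mono norm_triangle_le)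
    ultimately show "\<phi> + \<psi> \<in> carrier (dual_space V)"
      unfolding iff using CD(1,2) by (auto simp: distrib_left intro!: exI[of _ "C + D"])
  next
    fix c \<phi> assume "\<phi> \<in> carrier (dual_space V)"
    moreover from this obtain C where C: "0 \<le> C" "\<forall>x\<in>carrier V. cmod (\<phi> x) \<le> C * os_norm V x"
      unfolding iff by blast
    then have "cmod (c * \<phi> x) \<le> (cmod c * C) * os_norm V x" if "x \<in> carrier V" for x
      using that by (simp add: norm_mult mult.assoc mult_left_mono)
    ultimately show "c *\<^sub>C \<phi> \<in> carrier (dual_space V)"
      unfolding iff using C(1)
      by (auto simp: scaleC_fun_def scaleC_complex_def distrib_left intro!: exI[of _ "cmod c * C"])
  qed
next
  fix \<phi> assume \<phi>: "\<phi> \<in> carrier (dual_space V)"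
  then obtain C where C: "0 \<le> C" "\<And>x. x \<in> carrier V \<Longrightarrow> cmod (\<phi> x) \<le> C * os_norm V x"
    unfolding dual_carrier_iff[OF ruan_space_axioms] by blast
  have "cmat_norm m m (\<lambda>i j. \<phi> (X i j)) \<le> C" if "0 < m" "X \<in> mat_ball V m" for m X
  proof -
    have "cmat_norm m m (\<lambda>i j. \<phi> (X i j)) \<le> C * mnorm V m X"
      by (rule functional_completely_bounded[OF dual_clinear[OF \<phi>] ruan_space_axioms C \<open>0 < m\<close> mat_ballD(1)])
        (use that in auto)
    also have "\<dots> \<le> C * 1"
      using mat_ballD(2)[OF that(2)] C(1) by (intro mult_left_mono) auto
    finally show ?thesis by simp
  qed
  then show "bdd_above (amp_values V scalar_space 1 (\<lambda>k l. \<phi>))"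
    unfolding amp_values_scalar cmat_norm_mat_apply_1 by (auto intro!: bdd_aboveI)
  assume 0: "\<And>x. x \<in> unit_ball V \<Longrightarrow> \<phi> x = 0"
  have "\<phi> x = 0" for x
  proof (cases "x \<in> carrier V")
    case True
    then have "cmod (\<phi> x) \<le> 0 * os_norm V x"
      by (intro functional_bound_of_ball dual_clinear[OF \<phi>]) (auto simp: 0)
    then show ?thesis by simp
  qed (use \<phi> in \<open>simp add: dual_carrier_iff[OF ruan_space_axioms]\<close>)
  then show "\<phi> = 0" by auto
qed

lemma fspace_dual: "amp_space.fspace V (carrier (dual_space V)) = dual_space V"
  unfolding amp_space.fspace_def[OF amp_space_dual] by (simp add: dual_space_def)

text \<open>Limits exist on the ball, hence on the whole carrier by homogeneity; linearity and the
  bound by \<open>M\<close> pass to the limit.\<close>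

lemma operator_space_dual: "operator_space (dual_space V)"
proof -
  interpret dual: amp_space V "carrier (dual_space V)" by (rule amp_space_dual)
  note iff = dual_carrier_iff[OF ruan_space_axioms]
  have "operator_space dual.fspace"
  proof (rule dual.operator_space_fspace)
    fix f :: "nat \<Rightarrow> 'a \<Rightarrow> complex" and M
    assume f: "\<And>n. f n \<in> carrier (dual_space V)" and M: "\<And>n. os_norm dual.fspace (f n) \<le> M"
      and cauchy: "\<And>\<epsilon>. 0 < \<epsilon> \<Longrightarrow> \<exists>N. \<forall>m\<ge>N. \<forall>n\<ge>N. \<forall>x\<in>unit_ball V. cmod (f m x - f n x) \<le> \<epsilon>"
    have conv_ball: "convergent (\<lambda>n. f n x)" if "x \<in> unit_ball V" for x
    proof (rule Cauchy_convergent, rule metric_CauchyI)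
      fix \<epsilon> :: real assume "0 < \<epsilon>"
      then have "0 < \<epsilon> / 2" "\<epsilon> / 2 < \<epsilon>" by auto
      with cauchy[of "\<epsilon> / 2"] that show "\<exists>N. \<forall>m\<ge>N. \<forall>n\<ge>N. dist (f m x) (f n x) < \<epsilon>"
        unfolding dist_norm by (meson le_less_trans)
    qed
    have conv: "convergent (\<lambda>n. f n x)" if x: "x \<in> carrier V" for x
    proof -
      \<comment> \<open>Strictly larger than the norm, so the rescaled vector lies in the open ball,
        also for \<open>x = 0\<close>.\<close>
      let ?s = "os_norm V x + 1"
      let ?y = "of_real (1 / ?s) *\<^sub>C x"
      have y: "?y \<in> unit_ball V" "of_real ?s *\<^sub>C ?y = x"
        by (rule scale_into_unit_ball[OF x], simp)+
      then have "f n x = of_real ?s * f n ?y" for n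
        using functional_scaleC[OF dual_clinear[OF f[of n]] unit_ballD(1)[OF y(1)], of "of_real ?s"] by simp
      then show ?thesis
        using convergent_mult[OF convergent_const conv_ball[OF y(1)]] by simp
    qed
    define g where "g x = (if x \<in> carrier V then lim (\<lambda>n. f n x) else 0)" for x
    have lim: "(\<lambda>n. f n x) \<longlonglongrightarrow> g x" if "x \<in> carrier V" for x
      using conv[OF that] that by (simp add: g_def convergent_LIMSEQ_iff)
    have bound: "cmod (f n x) \<le> M * os_norm V x" if "x \<in> carrier V" for n x
      by (rule functional_bound_of_ball[OF dual_clinear[OF f] _ that])
        (rule order_trans[OF dual.cmod_le_os_norm[OF f] M])
    have "0 \<le> M"
      using order_trans[OF norm_ge_zero order_trans[OF dual.cmod_le_os_norm[OF f] M], of 0]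
      by (simp add: unit_ball_def)
    have "g \<in> carrier (dual_space V)"
      unfolding iff
    proof (intro conjI ballI allI exI[of _ M] impI \<open>0 \<le> M\<close>)
      fix x y assume xy: "x \<in> carrier V" "y \<in> carrier V"
      have "(\<lambda>n. f n (x + y)) \<longlonglongrightarrow> g x + g y"
        using tendsto_add[OF lim[OF xy(1)] lim[OF xy(2)]] functional_add[OF dual_clinear[OF f] xy] by simp
      with lim[OF carrier_add[OF xy]] show "g (x + y) = g x + g y" by (rule LIMSEQ_unique)
    next
      fix c x assume x: "x \<in> carrier V"
      have "(\<lambda>n. f n (c *\<^sub>C x)) \<longlonglongrightarrow> c * g x"
        using tendsto_mult_left[OF lim[OF x], of c] functional_scaleC[OF dual_clinear[OF f] x] by simp
      with lim[OF carrier_scaleC[OF x]] show "g (c *\<^sub>C x) = c * g x" by (rule LIMSEQ_unique)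
    next
      fix x assume "x \<in> carrier V"
      then show "cmod (g x) \<le> M * os_norm V x"
        using LIMSEQ_le_const2[OF tendsto_norm[OF lim]] bound by blast
    qed (simp add: g_def)
    then show "\<exists>g\<in>carrier (dual_space V). \<forall>x\<in>unit_ball V. (\<lambda>n. f n x) \<longlonglongrightarrow> g x"
      by (intro bexI[of _ g] ballI lim) (simp_all add: unit_ballD)
  qed
  then show ?thesis unfolding fspace_dual .
qed

lemma dual_cmod_le:
  assumes \<phi>: "\<phi> \<in> carrier (dual_space V)" and x: "x \<in> carrier V"
  shows "cmod (\<phi> x) \<le> os_norm (dual_space V) \<phi> * os_norm V x"
proof -
  interpret dual: amp_space V "carrier (dual_space V)" by (rule amp_space_dual)
  show ?thesis
    by (rule functional_bound_of_ball[OF dual_clinear[OF \<phi>] dual.cmod_le_os_norm[OF \<phi>, unfolded fspace_dual] x])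
qed

text \<open>With \<open>dual_cmod_le\<close>, this identifies the norm of a functional in the dual
  with its usual one, so norm estimates in the dual reduce to pointwise estimates.\<close>

lemma dual_os_norm_le:
  assumes \<phi>: "\<phi> \<in> carrier (dual_space V)" and C: "0 \<le> C" "\<And>x. x \<in> carrier V \<Longrightarrow> cmod (\<phi> x) \<le> C * os_norm V x"
  shows "os_norm (dual_space V) \<phi> \<le> C"
proof -
  interpret dual: amp_space V "carrier (dual_space V)" by (rule amp_space_dual)
  have "os_norm dual.fspace \<phi> \<le> C"
  proof (rule dual.os_norm_leI)
    fix m X assume mX: "0 < m" "X \<in> mat_ball V m"
    have "cmat_norm m m (\<lambda>i j. \<phi> (X i j)) \<le> C * mnorm V m X"
      by (rule functional_completely_bounded[OF dual_clinear[OF \<phi>] ruan_space_axioms C mX(1) mat_ballD(1)[OF mX(2)]])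
    also have "\<dots> \<le> C * 1"
      using mat_ballD(2)[OF mX(2)] C(1) by (intro mult_left_mono) auto
    finally show "cmat_norm m m (\<lambda>i j. \<phi> (X i j)) \<le> C" by simp
  qed
  then show ?thesis unfolding fspace_dual .
qed

text \<open>The supremum defining the norm of F only sees X in the open matrix ball. The entries of
  F are homogeneous, so rescaling X gives the general bound.\<close>

lemma dual_cmat_norm_le:
  assumes F: "F \<in> mats (dual_space V) n" and m: "0 < m" and X: "X \<in> mats V m"
  shows "cmat_norm (n * m) (n * m) (mat_apply m F X) \<le> mnorm (dual_space V) n F * mnorm V m X"
proof (rule le_mult_of_greater)
  interpret dual: amp_space V "carrier (dual_space V)" by (rule amp_space_dual)
  have le: "cmat_norm (n * m) (n * m) (mat_apply m F Y) \<le> mnorm (dual_space V) n F" if "Y \<in> mat_ball V m" for Y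
    using dual.cmat_norm_le_amp_norm[OF _ m that, of F n] F
    unfolding fspace_dual by (simp add: dual_space_def)
  show "0 \<le> mnorm (dual_space V) n F"
    using le[OF zero_in_mat_ball[OF m]] by (rule order_trans[OF cmat_norm_nonneg])
  fix s assume s: "mnorm V m X < s"
  then have s0: "0 < s" using mnorm_nonneg[OF m X] by simp
  let ?Y = "\<lambda>i j. of_real (1 / s) *\<^sub>C X i j"
  have Y: "?Y \<in> mat_ball V m"
    using X s s0 by (simp add: mat_ball_def mats_def carrier_scaleC mnorm_scaleC[OF m X] norm_divide)
  have "mat_apply m F X p q = of_real s * mat_apply m F ?Y p q" if "p < n * m" "q < n * m" for p q
  proof -
    have "F (p div m) (q div m) \<in> carrier (dual_space V)"
      using F that by (auto intro: matsD simp: less_mult_imp_div_less)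
    from functional_scaleC[OF dual_clinear[OF this]] show ?thesis
      using matsD[OF X] m s0 by (simp add: mat_apply_def)
  qed
  then have "cmat_norm (n * m) (n * m) (mat_apply m F X)
      = cmat_norm (n * m) (n * m) (\<lambda>p q. of_real s * mat_apply m F ?Y p q)"
    by (rule cmat_norm_cong)
  also have "\<dots> = s * cmat_norm (n * m) (n * m) (mat_apply m F ?Y)"
    using s0 by (simp add: cmat_norm_scale del: of_real_divide)
  also have "\<dots> \<le> s * mnorm (dual_space V) n F"
    using s0 le[OF Y] by simp
  finally show "cmat_norm (n * m) (n * m) (mat_apply m F X) \<le> mnorm (dual_space V) n F * s"
    by (simp add: mult.commute)
qed

lemma dual_mnorm_leI:
  assumes "\<And>m X. 0 < m \<Longrightarrow> X \<in> mat_ball V m \<Longrightarrow> cmat_norm (n * m) (n * m) (mat_apply m F X) \<le> K"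
  shows "mnorm (dual_space V) n F \<le> K"
  using amp_space.amp_norm_leI[OF amp_space_dual assms] by (simp add: dual_space_def)

end

section \<open>Closed subspaces of operator spaces\<close>

lemma carrier_sub_opspace [simp]: "carrier (sub_opspace W G) = G"
  and mnorm_sub_opspace [simp]: "mnorm (sub_opspace W G) = mnorm W"
  and os_norm_sub_opspace [simp]: "os_norm (sub_opspace W G) = os_norm W"
  by (auto simp: sub_opspace_def os_norm_def fun_eq_iff)

lemma (in ruan_space) ruan_space_sub:
  assumes "csubspace G" "G \<subseteq> carrier V"
  shows "ruan_space (sub_opspace V G)"
proof -
  have "X \<in> mats V n" if "X \<in> mats (sub_opspace V G) n" for X n
    using that assms(2) by (auto simp: mats_def)
  then show ?thesis
    by unfold_locales
      (simp_all add: assms(1) mnorm_triangle mnorm_scaleC mnorm_bimult mnorm_dsum,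
       blast intro: mnorm_cong, rule mnorm_eq_0, auto)
qed

lemma operator_space_sub:
  assumes V: "operator_space V" and "csubspace G" and closed: "closedin (os_topology V) G"
  shows "operator_space (sub_opspace V G)"
proof -
  interpret ruan_space V using V by (simp add: operator_space_iff)
  have G: "G \<subseteq> carrier V" using closedin_subset[OF closed] by simp
  interpret sub: ruan_space "sub_opspace V G" by (rule ruan_space_sub) fact+
  have "Metric_space.mcomplete (carrier (sub_opspace V G)) (os_dist (sub_opspace V G))"
    unfolding sub.mcomplete_iff unfolding carrier_sub_opspace os_norm_sub_opspace
  proof (intro allI impI, elim conjE)
    fix \<sigma> :: "nat \<Rightarrow> 'a"
    assume \<sigma>: "\<forall>n. \<sigma> n \<in> G" and "\<forall>\<epsilon>>0. \<exists>N. \<forall>m\<ge>N. \<forall>n\<ge>N. os_norm V (\<sigma> m - \<sigma> n) < \<epsilon>"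
    then obtain x where x: "x \<in> carrier V" "\<forall>\<epsilon>>0. \<exists>N. \<forall>n\<ge>N. os_norm V (\<sigma> n - x) < \<epsilon>"
      using V[unfolded operator_space_iff mcomplete_iff] G by blast
    have "x \<in> os_topology V closure_of G"
      unfolding os_topology_closure_of[OF G]
    proof (intro CollectI conjI x(1) allI impI)
      fix r :: real assume "0 < r"
      with x(2) obtain N where "os_norm V (\<sigma> N - x) < r" by blast
      with \<sigma> x(1) G show "\<exists>y\<in>G. os_norm V (x - y) < r"
        by (metis os_norm_minus_commute subsetD)
    qed
    then have "x \<in> G" using closure_of_closedin[OF closed] by simp
    with x(2) show "\<exists>x\<in>G. \<forall>\<epsilon>>0. \<exists>N. \<forall>n\<ge>N. os_norm V (\<sigma> n - x) < \<epsilon>" by blast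
  qed
  then show ?thesis by (simp add: operator_space_iff sub.ruan_space_axioms)
qed

section \<open>Scalar-valued holomorphic functions on the unit ball\<close>

text \<open>Cauchy's inequality, with radius \<open>R / 2\<close> about 0 for the first derivative
  and radius \<open>R / 4\<close> about points of the closed unit disc for the second. The latter
  circles stay inside the domain because \<open>2 \<le> R\<close> gives
  \<open>1 + R / 4 < R\<close>. A Taylor expansion at 0 then controls the remainder.\<close>

lemma cauchy_estimates:
  assumes hol: "g holomorphic_on ball 0 R" and bound: "\<And>t. t \<in> ball 0 R \<Longrightarrow> cmod (g t) \<le> M"
    and R: "0 < R"
  shows "cmod (deriv g 0) \<le> 2 * M / R"
    and "2 \<le> R \<Longrightarrow> cmod (g 1 - g 0 - deriv g 0) \<le> 32 * M / R\<^sup>2"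
proof -
  have est: "cmod ((deriv ^^ n) g \<xi>) \<le> fact n * M / r ^ n" if "0 < r" "cmod \<xi> + r < R" for n \<xi> r
  proof (rule Cauchy_inequality)
    have sub: "cball \<xi> r \<subseteq> ball 0 R"
    proof
      fix x assume "x \<in> cball \<xi> r"
      with that norm_triangle_sub[of x \<xi>] show "x \<in> ball 0 R"
        by (simp add: dist_norm norm_minus_commute)
    qed
    show "g holomorphic_on ball \<xi> r"
      using hol sub ball_subset_cball holomorphic_on_subset by (meson order_trans)
    show "continuous_on (cball \<xi> r) g"
      using hol sub holomorphic_on_imp_continuous_on holomorphic_on_subset by blast
    show "cmod (g x) \<le> M" if "cmod (\<xi> - x) = r" for x
      using that sub by (intro bound) (auto simp: dist_norm)
  qed (use that in auto)
  show "cmod (deriv g 0) \<le> 2 * M / R"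
    using est[of "R / 2" 0 1] R by (simp add: mult.commute)
  assume R2: "2 \<le> R"
  \<comment> \<open>The Cauchy bound on the second derivative, equal to
    \<open>32 * M / R\<^sup>2\<close>; the Taylor estimate used here divides it by
    \<open>fact 1\<close>.\<close>
  let ?B = "2 * M / (R / 4)\<^sup>2"
  have "cmod ((deriv ^^ 0) g 1 - (\<Sum>i\<le>1. (deriv ^^ i) g 0 * (1 - 0) ^ i / fact i))
      \<le> ?B * cmod (1 - 0) ^ Suc 1 / fact 1"
  proof (rule complex_Taylor[where S = "cball 0 1"])
    fix i and x :: complex assume x: "x \<in> cball 0 1"
    then have "x \<in> ball 0 R" using R2 by auto
    then have "((deriv ^^ i) g has_field_derivative deriv ((deriv ^^ i) g) x) (at x)"
      using holomorphic_higher_deriv[OF hol open_ball] holomorphic_derivI by blast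
    then show "((deriv ^^ i) g has_field_derivative (deriv ^^ Suc i) g x) (at x within cball 0 1)"
      by (simp add: has_field_derivative_at_within)
    show "cmod ((deriv ^^ Suc 1) g x) \<le> ?B"
      using est[of "R / 4" x 2] x R2 by (simp add: eval_nat_numeral)
  qed auto
  then show "cmod (g 1 - g 0 - deriv g 0) \<le> 32 * M / R\<^sup>2"
    by (simp add: power_divide algebra_simps)
qed

text \<open>The Frechet derivative appears only under an existential quantifier. The one-variable
  derivative along a complex line recovers its values as an explicit expression in
  \<open>f\<close>.\<close>

definition line_deriv :: "('a::complex_vector \<Rightarrow> complex) \<Rightarrow> 'a \<Rightarrow> 'a \<Rightarrow> complex" where
  "line_deriv f x h = deriv (\<lambda>t. f (x + t *\<^sub>C h)) 0"

context ruan_space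
begin

lemma unit_ball_add_scaleC:
  assumes "x \<in> unit_ball V" "h \<in> carrier V" "cmod t * os_norm V h < 1 - os_norm V x"
  shows "x + t *\<^sub>C h \<in> unit_ball V"
  using assms os_norm_triangle[of x "t *\<^sub>C h"]
  by (simp add: unit_ball_def carrier_add carrier_scaleC os_norm_scaleC)

lemma unit_ball_add:
  assumes "x \<in> unit_ball V" "h \<in> carrier V" "os_norm V h < 1 - os_norm V x"
  shows "x + h \<in> unit_ball V"
  using unit_ball_add_scaleC[of x h 1] assms by (simp add: scaleC_one)

lemma frechet_imp_line_derivative:
  assumes x: "x \<in> unit_ball V" and h: "h \<in> carrier V"
    and D: "clinear_map V scalar_space D"
    and diff: "\<forall>\<epsilon>>0. \<exists>\<delta>>0. \<forall>h\<in>carrier V. os_norm V h < \<delta> \<longrightarrow> x + h \<in> unit_ball V \<longrightarrow>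
        cmod (f (x + h) - f x - D h) \<le> \<epsilon> * os_norm V h"
  shows "((\<lambda>t. f (x + t *\<^sub>C h)) has_field_derivative D h) (at 0)"
  unfolding has_field_derivative_iff
proof (rule LIM_I)
  \<comment> \<open>Positive even for \<open>h = 0\<close>. Differentiability is used with error
    \<open>r / a\<close>, so that the factor \<open>os_norm V h < a\<close> leaves less than
    \<open>r\<close>; the radius \<open>s\<close> below keeps \<open>t *\<^sub>C h\<close> within
    \<delta> and \<open>x + t *\<^sub>C h\<close> in the ball.\<close>
  define a where "a = os_norm V h + 1"
  have a: "0 < a" "os_norm V h < a" using os_norm_nonneg[OF h] by (simp_all add: a_def)
  fix r :: real assume "0 < r"
  then have "0 < r / a" using a by simp
  with diff obtain \<delta> where \<delta>: "0 < \<delta>"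
    and le: "\<And>h. h \<in> carrier V \<Longrightarrow> os_norm V h < \<delta> \<Longrightarrow> x + h \<in> unit_ball V \<Longrightarrow>
        cmod (f (x + h) - f x - D h) \<le> r / a * os_norm V h"
    by meson
  define s where "s = min \<delta> (1 - os_norm V x) / a"
  have s: "0 < s" using \<delta> a unit_ballD(2)[OF x] by (simp add: s_def)
  show "\<exists>s>0. \<forall>t. t \<noteq> 0 \<and> norm (t - 0) < s \<longrightarrow>
      norm ((f (x + t *\<^sub>C h) - f (x + 0 *\<^sub>C h)) / (t - 0) - D h) < r"
  proof (intro exI[of _ s] conjI s allI impI)
    fix t :: complex assume t: "t \<noteq> 0 \<and> norm (t - 0) < s"
    have "cmod t * os_norm V h \<le> cmod t * a" using a by (intro mult_left_mono) auto
    also have "\<dots> < min \<delta> (1 - os_norm V x)"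
      using t a by (simp add: s_def pos_less_divide_eq)
    finally have lt: "cmod t * os_norm V h < \<delta>" "cmod t * os_norm V h < 1 - os_norm V x" by simp_all
    have "cmod (f (x + t *\<^sub>C h) - f x - D (t *\<^sub>C h)) \<le> r / a * (cmod t * os_norm V h)"
      using le[of "t *\<^sub>C h"] lt unit_ball_add_scaleC[OF x h lt(2)] h
      by (simp add: carrier_scaleC os_norm_scaleC)
    also have "\<dots> < r / a * (cmod t * a)"
      using \<open>0 < r / a\<close> t a by (intro mult_strict_left_mono) auto
    also have "\<dots> = r * cmod t" using a by simp
    finally have "cmod (f (x + t *\<^sub>C h) - f x - t * D h) < r * cmod t"
      using functional_scaleC[OF D h] by simp
    moreover have "(f (x + t *\<^sub>C h) - f (x + 0 *\<^sub>C h)) / (t - 0) - D h = (f (x + t *\<^sub>C h) - f x - t * D h) / t"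
      using t by (simp add: diff_divide_distrib)
    ultimately show "norm ((f (x + t *\<^sub>C h) - f (x + 0 *\<^sub>C h)) / (t - 0) - D h) < r"
      using t by (simp add: norm_divide pos_divide_less_eq)
  qed
qed

text \<open>\<open>line_deriv f x\<close> agrees on the carrier with any Frechet derivative at
  \<open>x\<close>, from which it inherits linearity in the direction.\<close>

lemma holomorphic_line_derivative:
  assumes f: "holomorphic_ball V scalar_space f" and x: "x \<in> unit_ball V"
  shows "clinear_map V scalar_space (line_deriv f x)"
    and "h \<in> carrier V \<Longrightarrow> ((\<lambda>t. f (x + t *\<^sub>C h)) has_field_derivative line_deriv f x h) (at 0)"
proof -
  from f x obtain D where D: "bounded_clinear_map V scalar_space D"
    and diff: "\<forall>\<epsilon>>0. \<exists>\<delta>>0. \<forall>h\<in>carrier V. os_norm V h < \<delta> \<longrightarrow> x + h \<in> unit_ball V \<longrightarrow>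
        cmod (f (x + h) - f x - D h) \<le> \<epsilon> * os_norm V h"
    unfolding holomorphic_ball_def frechet_differentiable_at_def os_norm_scalar_space by meson
  have lin: "clinear_map V scalar_space D" using D by (simp add: bounded_clinear_map_def)
  have der: "((\<lambda>t. f (x + t *\<^sub>C h)) has_field_derivative D h) (at 0)" if "h \<in> carrier V" for h
    by (rule frechet_imp_line_derivative[OF x that lin diff])
  have eq: "line_deriv f x h = D h" if "h \<in> carrier V" for h
    unfolding line_deriv_def by (rule DERIV_imp_deriv[OF der[OF that]])
  show "clinear_map V scalar_space (line_deriv f x)"
    using lin by (simp add: clinear_map_def eq carrier_add carrier_scaleC)
  show "((\<lambda>t. f (x + t *\<^sub>C h)) has_field_derivative line_deriv f x h) (at 0)" if "h \<in> carrier V"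
    using der[OF that] eq[OF that] by simp
qed

lemma holomorphic_on_line:
  assumes f: "holomorphic_ball V scalar_space f" and x: "x \<in> unit_ball V" and h: "h \<in> carrier V"
    and R: "R * os_norm V h \<le> 1 - os_norm V x"
  shows "(\<lambda>t. f (x + t *\<^sub>C h)) holomorphic_on ball 0 R"
    and "t \<in> ball 0 R \<Longrightarrow> x + t *\<^sub>C h \<in> unit_ball V"
proof -
  show ball: "x + t *\<^sub>C h \<in> unit_ball V" if "t \<in> ball 0 R" for t
  proof (cases "os_norm V h = 0")
    case False
    with h have "cmod t * os_norm V h < R * os_norm V h"
      using that os_norm_nonneg[OF h] by (intro mult_strict_right_mono) auto
    with R show ?thesis by (intro unit_ball_add_scaleC[OF x h]) simp
  qed (use unit_ballD(2)[OF x] in \<open>intro unit_ball_add_scaleC[OF x h], simp\<close>)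
  show "(\<lambda>t. f (x + t *\<^sub>C h)) holomorphic_on ball 0 R"
    unfolding holomorphic_on_open[OF open_ball]
  proof
    fix t :: complex assume "t \<in> ball 0 R"
    \<comment> \<open>Differentiability at parameter \<open>t\<close> is differentiability at
      parameter 0 of the same line based at \<open>x + t *\<^sub>C h\<close>.\<close>
    from holomorphic_line_derivative(2)[OF f ball[OF this] h]
    have "((\<lambda>s. f (x + (s + t) *\<^sub>C h)) has_field_derivative line_deriv f (x + t *\<^sub>C h) h) (at 0)"
      by (simp add: scaleC_add_left add_ac)
    then have "((\<lambda>s. f (x + s *\<^sub>C h)) has_field_derivative line_deriv f (x + t *\<^sub>C h) h) (at (0 + t))"
      unfolding DERIV_shift .
    then show "\<exists>f'. ((\<lambda>t. f (x + t *\<^sub>C h)) has_field_derivative f') (at t)" by auto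
  qed
qed

text \<open>With r = 1 - ||x||, the sum of the constants that \<open>cauchy_estimates\<close> yields
  for the radius R = r / ||h||: 2 / r for the derivative and 32 / r^2 for the remainder. One
  constant then serves both estimates.\<close>

definition cauchy_const :: "'a \<Rightarrow> real" where
  "cauchy_const x = 2 / (1 - os_norm V x) + 32 / (1 - os_norm V x)\<^sup>2"

lemma cauchy_const_nonneg: "x \<in> unit_ball V \<Longrightarrow> 0 \<le> cauchy_const x"
  by (simp add: cauchy_const_def unit_ball_def)

text \<open>The line through \<open>x\<close> in direction \<open>h\<close> stays in the ball for
  parameters of modulus below (1 - ||x||) / ||h||, so \<open>cauchy_estimates\<close> applies. The
  constants depend on \<open>f\<close> only through the factor \<open>M\<close>.\<close>

lemma line_deriv_estimates:
  assumes f: "holomorphic_ball V scalar_space f" and M: "\<And>x. x \<in> unit_ball V \<Longrightarrow> cmod (f x) \<le> M"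
    and x: "x \<in> unit_ball V" and h: "h \<in> carrier V"
  shows "cmod (line_deriv f x h) \<le> cauchy_const x * M * os_norm V h"
    and "2 * os_norm V h \<le> 1 - os_norm V x \<Longrightarrow>
      cmod (f (x + h) - f x - line_deriv f x h) \<le> cauchy_const x * M * (os_norm V h)\<^sup>2"
proof -
  define r where "r = 1 - os_norm V x"
  have r: "0 < r" using unit_ballD(2)[OF x] by (simp add: r_def)
  have M0: "0 \<le> M" using M[OF x] by (meson norm_ge_zero order_trans)
  have "cmod (line_deriv f x h) \<le> cauchy_const x * M * os_norm V h \<and> (2 * os_norm V h \<le> r \<longrightarrow>
      cmod (f (x + h) - f x - line_deriv f x h) \<le> cauchy_const x * M * (os_norm V h)\<^sup>2)"
  \<comment> \<open>The radius \<open>R\<close> divides by the norm of \<open>h\<close>, so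
    \<open>h = 0\<close> is treated apart.\<close>
  proof (cases "os_norm V h = 0")
    case True
    then have "h = 0" by (rule os_norm_eq_0[OF h])
    then show ?thesis by (simp add: line_deriv_def)
  next
    case False
    then have n: "0 < os_norm V h" using os_norm_nonneg[OF h] by simp
    define R where "R = r / os_norm V h"
    have R: "0 < R" "R * os_norm V h \<le> 1 - os_norm V x" using r n by (simp_all add: R_def flip: r_def)
    note hol = holomorphic_on_line[OF f x h R(2)]
    note est = cauchy_estimates[OF hol(1) M[OF hol(2)] R(1), folded line_deriv_def]
    have "cmod (line_deriv f x h) \<le> 2 * M / R" by (rule est(1))
    also have "\<dots> = 2 / r * M * os_norm V h" by (simp add: R_def)
    also have "\<dots> \<le> cauchy_const x * M * os_norm V h"
      using M0 n by (intro mult_right_mono) (auto simp: cauchy_const_def r_def)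
    finally have 1: "cmod (line_deriv f x h) \<le> cauchy_const x * M * os_norm V h" .
    have 2: "cmod (f (x + h) - f x - line_deriv f x h) \<le> cauchy_const x * M * (os_norm V h)\<^sup>2"
      if "2 * os_norm V h \<le> r"
    proof -
      have "2 \<le> R" using that n by (simp add: R_def pos_le_divide_eq)
      with est(2) have "cmod (f (x + h) - f x - line_deriv f x h) \<le> 32 * M / R\<^sup>2"
        by (simp add: scaleC_one)
      also have "\<dots> = 32 / r\<^sup>2 * M * (os_norm V h)\<^sup>2" by (simp add: R_def power_divide)
      also have "\<dots> \<le> cauchy_const x * M * (os_norm V h)\<^sup>2"
        using M0 n r by (intro mult_right_mono) (auto simp: cauchy_const_def r_def)
      finally show ?thesis .
    qed
    from 1 2 show ?thesis by blast
  qed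
  then show "cmod (line_deriv f x h) \<le> cauchy_const x * M * os_norm V h"
    and "2 * os_norm V h \<le> 1 - os_norm V x \<Longrightarrow>
      cmod (f (x + h) - f x - line_deriv f x h) \<le> cauchy_const x * M * (os_norm V h)\<^sup>2"
    by (simp_all add: r_def)
qed

text \<open>A quadratic remainder for small \<open>h\<close> is eventually below any multiple of the
  norm. This is the common criterion for linear combinations, for limits in H, and for phi composed
  with delta.\<close>

lemma frechet_differentiable_atI:
  assumes x: "x \<in> unit_ball V" and D: "clinear_map V scalar_space D" and K: "0 \<le> K"
    and bound: "\<And>h. h \<in> carrier V \<Longrightarrow> cmod (D h) \<le> K * os_norm V h"
    and rem: "\<And>h. h \<in> carrier V \<Longrightarrow> 2 * os_norm V h \<le> 1 - os_norm V x \<Longrightarrow>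
      cmod (f (x + h) - f x - D h) \<le> K * (os_norm V h)\<^sup>2"
  shows "frechet_differentiable_at V scalar_space f x"
  unfolding frechet_differentiable_at_def os_norm_scalar_space
proof (intro exI[of _ D] conjI allI impI)
  show "bounded_clinear_map V scalar_space D"
    using D bound by (auto simp: bounded_clinear_map_def)
  fix \<epsilon> :: real assume \<epsilon>: "0 < \<epsilon>"
  \<comment> \<open>The first entry makes \<open>rem\<close> applicable, the second gives
    \<open>K * os_norm V h \<le> \<epsilon>\<close>; adding 1 to \<open>K\<close> avoids a zero
    denominator.\<close>
  define \<delta> where "\<delta> = min ((1 - os_norm V x) / 2) (\<epsilon> / (K + 1))"
  have "0 < \<delta>" using \<epsilon> K unit_ballD(2)[OF x] by (simp add: \<delta>_def)
  moreover have "cmod (f (x + h) - f x - D h) \<le> \<epsilon> * os_norm V h"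
    if h: "h \<in> carrier V" and lt: "os_norm V h < \<delta>" for h
  proof -
    have "2 * os_norm V h \<le> 1 - os_norm V x" "os_norm V h \<le> \<epsilon> / (K + 1)"
      using lt by (simp_all add: \<delta>_def)
    then have "(K + 1) * os_norm V h \<le> \<epsilon>" using K by (simp add: pos_le_divide_eq mult.commute)
    then have "K * os_norm V h \<le> \<epsilon>"
      using os_norm_nonneg[OF h] by (simp add: distrib_right)
    then have "K * os_norm V h * os_norm V h \<le> \<epsilon> * os_norm V h"
      by (rule mult_right_mono[OF _ os_norm_nonneg[OF h]])
    with rem[OF h \<open>2 * os_norm V h \<le> 1 - os_norm V x\<close>] show ?thesis
      by (simp add: power2_eq_square mult.assoc)
  qed
  ultimately show "\<exists>\<delta>>0. \<forall>h\<in>carrier V. os_norm V h < \<delta> \<longrightarrow> x + h \<in> unit_ball V \<longrightarrow>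
      cmod (f (x + h) - f x - D h) \<le> \<epsilon> * os_norm V h" by blast
qed


section \<open>The operator space of completely bounded holomorphic functions\<close>

lemma Hcb_iff:
  "f \<in> carrier (Hcb V scalar_space) \<longleftrightarrow> holomorphic_ball V scalar_space f \<and>
    (\<exists>M. \<forall>m X. 0 < m \<longrightarrow> X \<in> mat_ball V m \<longrightarrow> cmat_norm m m (\<lambda>i j. f (X i j)) \<le> M) \<and>
    (\<forall>x. x \<notin> unit_ball V \<longrightarrow> f x = 0)"
proof -
  have "bdd_above (amp_values V scalar_space 1 (\<lambda>k l. f)) \<longleftrightarrow>
      (\<exists>M. \<forall>m X. 0 < m \<longrightarrow> X \<in> mat_ball V m \<longrightarrow> cmat_norm m m (\<lambda>i j. f (X i j)) \<le> M)"
    unfolding bdd_above_def amp_values_scalar cmat_norm_mat_apply_1 by (rule ex_cong1) blast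
  then show ?thesis by (simp add: Hcb_def)
qed

lemma HcbI:
  assumes "\<And>x. x \<in> unit_ball V \<Longrightarrow> frechet_differentiable_at V scalar_space f x"
    and "\<And>m X. 0 < m \<Longrightarrow> X \<in> mat_ball V m \<Longrightarrow> cmat_norm m m (\<lambda>i j. f (X i j)) \<le> M"
    and "\<And>x. x \<notin> unit_ball V \<Longrightarrow> f x = 0"
  shows "f \<in> carrier (Hcb V scalar_space)"
  unfolding Hcb_iff holomorphic_ball_def using assms by auto

lemma HcbE:
  assumes "f \<in> carrier (Hcb V scalar_space)"
  obtains M where "0 \<le> M" "\<forall>x\<in>unit_ball V. cmod (f x) \<le> M"
    "\<forall>m X. 0 < m \<longrightarrow> X \<in> mat_ball V m \<longrightarrow> cmat_norm m m (\<lambda>i j. f (X i j)) \<le> M"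
proof -
  from assms obtain M where M: "\<And>m X. 0 < m \<Longrightarrow> X \<in> mat_ball V m \<Longrightarrow> cmat_norm m m (\<lambda>i j. f (X i j)) \<le> M"
    unfolding Hcb_iff by blast
  have le: "cmod (f x) \<le> M" if "x \<in> unit_ball V" for x
    using M[OF _ unit_ball_in_mat_ball[OF that]] by simp
  have "0 \<in> unit_ball V" by (simp add: unit_ball_def)
  from le[OF this] have "0 \<le> M" by (rule order_trans[OF norm_ge_zero])
  then show thesis using le M by (intro that[of M]) auto
qed

lemma Hcb_holomorphic: "f \<in> carrier (Hcb V scalar_space) \<Longrightarrow> holomorphic_ball V scalar_space f"
  and Hcb_outside: "f \<in> carrier (Hcb V scalar_space) \<Longrightarrow> x \<notin> unit_ball V \<Longrightarrow> f x = 0"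
  by (simp_all add: Hcb_iff)

text \<open>The two coefficients cover sums, scalar multiples and differences at once. The
  derivative and remainder estimates of both functions add up.\<close>

lemma frechet_differentiable_scaled_sum:
  assumes f: "f \<in> carrier (Hcb V scalar_space)" and g: "g \<in> carrier (Hcb V scalar_space)"
    and x: "x \<in> unit_ball V"
  shows "frechet_differentiable_at V scalar_space (\<lambda>x. a * f x + b * g x) x"
proof -
  obtain M where M: "0 \<le> M" "\<forall>x\<in>unit_ball V. cmod (f x) \<le> M"
    "\<forall>m X. 0 < m \<longrightarrow> X \<in> mat_ball V m \<longrightarrow> cmat_norm m m (\<lambda>i j. f (X i j)) \<le> M"
    by (rule HcbE[OF f])
  obtain N where N: "0 \<le> N" "\<forall>x\<in>unit_ball V. cmod (g x) \<le> N"
    "\<forall>m X. 0 < m \<longrightarrow> X \<in> mat_ball V m \<longrightarrow> cmat_norm m m (\<lambda>i j. g (X i j)) \<le> N"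
    by (rule HcbE[OF g])
  note F = line_deriv_estimates[OF Hcb_holomorphic[OF f] M(2)[rule_format] x]
  note G = line_deriv_estimates[OF Hcb_holomorphic[OF g] N(2)[rule_format] x]
  note lin = holomorphic_line_derivative(1)[OF Hcb_holomorphic x]
  let ?c = "cauchy_const x"
  let ?K = "cmod a * (?c * M) + cmod b * (?c * N)"
  have le: "cmod (a * u + b * v) \<le> ?K * s" if "cmod u \<le> ?c * M * s" "cmod v \<le> ?c * N * s" for u v s
  proof -
    have "cmod (a * u + b * v) \<le> cmod a * cmod u + cmod b * cmod v"
      by (rule order_trans[OF norm_triangle_ineq]) (simp add: norm_mult)
    also have "\<dots> \<le> cmod a * (?c * M * s) + cmod b * (?c * N * s)"
      using that by (intro add_mono mult_left_mono) auto
    finally show ?thesis by (simp add: distrib_right mult.assoc)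
  qed
  show ?thesis
  proof (rule frechet_differentiable_atI[OF x, where K = ?K and D = "\<lambda>h. a * line_deriv f x h + b * line_deriv g x h"])
    show "clinear_map V scalar_space (\<lambda>h. a * line_deriv f x h + b * line_deriv g x h)"
      using lin[OF f] lin[OF g]
      by (simp add: clinear_map_def scaleC_complex_def) (simp add: distrib_left mult_ac)
    show "0 \<le> ?K" using M(1) N(1) cauchy_const_nonneg[OF x] by simp
    fix h assume h: "h \<in> carrier V"
    show "cmod (a * line_deriv f x h + b * line_deriv g x h) \<le> ?K * os_norm V h"
      by (rule le[OF F(1) G(1)]) (fact h | assumption)+
    assume small: "2 * os_norm V h \<le> 1 - os_norm V x"
    have "cmod (a * (f (x + h) - f x - line_deriv f x h) + b * (g (x + h) - g x - line_deriv g x h))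
        \<le> ?K * (os_norm V h)\<^sup>2"
      by (rule le[OF F(2) G(2)]) (fact h | fact small | assumption)+
    then show "cmod (a * f (x + h) + b * g (x + h) - (a * f x + b * g x) -
        (a * line_deriv f x h + b * line_deriv g x h)) \<le> ?K * (os_norm V h)\<^sup>2"
      by (simp add: right_diff_distrib algebra_simps)
  qed
qed

lemma Hcb_scaled_sum:
  assumes f: "f \<in> carrier (Hcb V scalar_space)" and g: "g \<in> carrier (Hcb V scalar_space)"
  shows "(\<lambda>x. a * f x + b * g x) \<in> carrier (Hcb V scalar_space)"
proof -
  obtain M where M: "0 \<le> M" "\<forall>x\<in>unit_ball V. cmod (f x) \<le> M"
    "\<forall>m X. 0 < m \<longrightarrow> X \<in> mat_ball V m \<longrightarrow> cmat_norm m m (\<lambda>i j. f (X i j)) \<le> M"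
    by (rule HcbE[OF f])
  obtain N where N: "0 \<le> N" "\<forall>x\<in>unit_ball V. cmod (g x) \<le> N"
    "\<forall>m X. 0 < m \<longrightarrow> X \<in> mat_ball V m \<longrightarrow> cmat_norm m m (\<lambda>i j. g (X i j)) \<le> N"
    by (rule HcbE[OF g])
  show ?thesis
  proof (rule HcbI)
    show "cmat_norm m m (\<lambda>i j. a * f (X i j) + b * g (X i j)) \<le> cmod a * M + cmod b * N"
      if "0 < m" "X \<in> mat_ball V m" for m X
    proof (rule order_trans[OF cmat_norm_triangle])
      show "cmat_norm m m (\<lambda>i j. a * f (X i j)) + cmat_norm m m (\<lambda>i j. b * g (X i j)) \<le> cmod a * M + cmod b * N"
        unfolding cmat_norm_scale using M(3)[rule_format, OF that] N(3)[rule_format, OF that] by (intro add_mono mult_left_mono) auto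
    qed
  qed (simp_all add: frechet_differentiable_scaled_sum[OF f g] Hcb_outside[OF f] Hcb_outside[OF g])
qed

lemma Hcb_zero: "0 \<in> carrier (Hcb V scalar_space)"
proof (rule HcbI[where M = 0])
  show "frechet_differentiable_at V scalar_space 0 x" if "x \<in> unit_ball V" for x
    by (rule frechet_differentiable_atI[OF that, where D = "\<lambda>_. 0" and K = 0])
      (auto simp: clinear_map_def)
qed auto

lemma amp_space_Hcb: "amp_space V (carrier (Hcb V scalar_space))"
proof
  show "csubspace (carrier (Hcb V scalar_space))"
  proof (rule complex_vector.subspaceI)
    fix f g assume fg: "f \<in> carrier (Hcb V scalar_space)" "g \<in> carrier (Hcb V scalar_space)"
    have "f + g = (\<lambda>x. 1 * f x + 1 * g x)" by auto
    then show "f + g \<in> carrier (Hcb V scalar_space)" using Hcb_scaled_sum[OF fg] by metis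
  next
    fix c f assume f: "f \<in> carrier (Hcb V scalar_space)"
    have "c *\<^sub>C f = (\<lambda>x. c * f x + 0 * f x)" by (simp add: scaleC_fun_def scaleC_complex_def)
    then show "c *\<^sub>C f \<in> carrier (Hcb V scalar_space)" using Hcb_scaled_sum[OF f f] by metis
  qed (rule Hcb_zero)
  fix f assume f: "f \<in> carrier (Hcb V scalar_space)"
  then show "bdd_above (amp_values V scalar_space 1 (\<lambda>k l. f))" by (simp add: Hcb_def)
  assume "\<And>x. x \<in> unit_ball V \<Longrightarrow> f x = 0"
  then show "f = 0" using Hcb_outside[OF f] by (metis ext zero_fun_apply)
qed

lemma fspace_Hcb: "amp_space.fspace V (carrier (Hcb V scalar_space)) = Hcb V scalar_space"
  unfolding amp_space.fspace_def[OF amp_space_Hcb] by (simp add: Hcb_def)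

text \<open>A Weierstrass argument. Estimates for differences of the sequence make the directional
  derivatives Cauchy, and the limit inherits linearity and the quadratic remainder; complete
  boundedness passes to the limit by \<open>cmat_norm_limit_le\<close>.\<close>

lemma operator_space_Hcb: "operator_space (Hcb V scalar_space)"
proof -
  interpret H: amp_space V "carrier (Hcb V scalar_space)" by (rule amp_space_Hcb)
  have "operator_space H.fspace"
  proof (rule H.operator_space_fspace)
    fix f :: "nat \<Rightarrow> 'a \<Rightarrow> complex" and M
    assume f: "\<And>n. f n \<in> carrier (Hcb V scalar_space)" and M: "\<And>n. os_norm H.fspace (f n) \<le> M"
      and cauchy: "\<And>\<epsilon>. 0 < \<epsilon> \<Longrightarrow> \<exists>N. \<forall>m\<ge>N. \<forall>n\<ge>N. \<forall>x\<in>unit_ball V. cmod (f m x - f n x) \<le> \<epsilon>"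
    note hol = Hcb_holomorphic[OF f]
    have M0: "0 \<le> M"
      using order_trans[OF norm_ge_zero order_trans[OF H.cmod_le_os_norm[OF f] M], of 0]
      by (simp add: unit_ball_def)
    have bound: "cmod (f n x) \<le> M" if "x \<in> unit_ball V" for n x
      using order_trans[OF H.cmod_le_os_norm[OF f that] M] .
    have conv: "convergent (\<lambda>n. f n x)" if "x \<in> unit_ball V" for x
    proof (rule Cauchy_convergent, rule metric_CauchyI)
      fix \<epsilon> :: real assume "0 < \<epsilon>"
      then have "0 < \<epsilon> / 2" "\<epsilon> / 2 < \<epsilon>" by auto
      with cauchy[of "\<epsilon> / 2"] that show "\<exists>N. \<forall>m\<ge>N. \<forall>n\<ge>N. dist (f m x) (f n x) < \<epsilon>"
        unfolding dist_norm by (meson le_less_trans)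
    qed
    define g where "g x = (if x \<in> unit_ball V then lim (\<lambda>n. f n x) else 0)" for x
    have lim: "(\<lambda>n. f n x) \<longlonglongrightarrow> g x" if "x \<in> unit_ball V" for x
      using conv[OF that] that by (simp add: g_def convergent_LIMSEQ_iff)
    have "g \<in> carrier (Hcb V scalar_space)"
    proof (rule HcbI)
      fix x assume x: "x \<in> unit_ball V"
      have diff: "line_deriv (\<lambda>y. f m y - f n y) x h = line_deriv (f m) x h - line_deriv (f n) x h"
        if "h \<in> carrier V" for m n h
        unfolding line_deriv_def[of "\<lambda>y. f m y - f n y"]
        by (rule DERIV_imp_deriv) (intro DERIV_diff holomorphic_line_derivative(2) hol x that)
      have conv_deriv: "convergent (\<lambda>n. line_deriv (f n) x h)" if h: "h \<in> carrier V" for h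
      proof (rule Cauchy_convergent, rule metric_CauchyI)
        fix \<epsilon> :: real assume \<epsilon>: "0 < \<epsilon>"
        \<comment> \<open>The added 1 makes \<open>K\<close> positive and the final inequality
          strict.\<close>
        define K where "K = cauchy_const x * os_norm V h + 1"
        have K: "0 < K"
          using cauchy_const_nonneg[OF x] os_norm_nonneg[OF h] by (simp add: K_def add_nonneg_pos)
        from cauchy[of "\<epsilon> / K"] \<epsilon> K obtain N where
          N: "\<And>m n y. m \<ge> N \<Longrightarrow> n \<ge> N \<Longrightarrow> y \<in> unit_ball V \<Longrightarrow> cmod (f m y - f n y) \<le> \<epsilon> / K"
          by (metis divide_pos_pos)
        have "dist (line_deriv (f m) x h) (line_deriv (f n) x h) < \<epsilon>" if mn: "m \<ge> N" "n \<ge> N" for m n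
        proof -
          \<comment> \<open>The difference is itself holomorphic, so its derivative is controlled by
            its supremum on the ball, which is at most \<open>\<epsilon> / K\<close>.\<close>
          have "(\<lambda>y. 1 * f m y + (-1) * f n y) \<in> carrier (Hcb V scalar_space)"
            by (rule Hcb_scaled_sum[OF f f])
          then have "holomorphic_ball V scalar_space (\<lambda>y. f m y - f n y)"
            using Hcb_holomorphic by simp
          from line_deriv_estimates(1)[OF this N[OF mn] x h]
          have "cmod (line_deriv (f m) x h - line_deriv (f n) x h) \<le> cauchy_const x * (\<epsilon> / K) * os_norm V h"
            by (simp add: diff[OF h])
          also have "\<dots> = (K - 1) * (\<epsilon> / K)" by (simp add: K_def)
          also have "\<dots> < K * (\<epsilon> / K)" using K \<epsilon> by (intro mult_strict_right_mono) auto
          finally show ?thesis using K by (simp add: dist_norm)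
        qed
        then show "\<exists>N. \<forall>m\<ge>N. \<forall>n\<ge>N. dist (line_deriv (f m) x h) (line_deriv (f n) x h) < \<epsilon>" by blast
      qed
      define D where "D h = lim (\<lambda>n. line_deriv (f n) x h)" for h
      have limD: "(\<lambda>n. line_deriv (f n) x h) \<longlonglongrightarrow> D h" if "h \<in> carrier V" for h
        using conv_deriv[OF that] by (simp add: D_def convergent_LIMSEQ_iff)
      note lin = holomorphic_line_derivative(1)[OF hol x]
      show "frechet_differentiable_at V scalar_space g x"
      proof (rule frechet_differentiable_atI[OF x, where K = "cauchy_const x * M" and D = D])
        show "0 \<le> cauchy_const x * M" using cauchy_const_nonneg[OF x] M0 by simp
        show "clinear_map V scalar_space D"
          unfolding clinear_map_def
        proof (intro conjI ballI allI)
          fix h k assume hk: "h \<in> carrier V" "k \<in> carrier V"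
          have "(\<lambda>n. line_deriv (f n) x (h + k)) \<longlonglongrightarrow> D h + D k"
            using tendsto_add[OF limD[OF hk(1)] limD[OF hk(2)]] functional_add[OF lin hk] by simp
          with limD[OF carrier_add[OF hk]] show "D (h + k) = D h + D k" by (rule LIMSEQ_unique)
        next
          fix c h assume h: "h \<in> carrier V"
          have "(\<lambda>n. line_deriv (f n) x (c *\<^sub>C h)) \<longlonglongrightarrow> c * D h"
            using tendsto_mult_left[OF limD[OF h], of c] functional_scaleC[OF lin h] by simp
          with limD[OF carrier_scaleC[OF h]] show "D (c *\<^sub>C h) = c *\<^sub>C D h"
            unfolding scaleC_complex_def by (rule LIMSEQ_unique)
        qed simp
        fix h assume h: "h \<in> carrier V"
        show "cmod (D h) \<le> cauchy_const x * M * os_norm V h"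
          by (rule LIMSEQ_le_const2[OF tendsto_norm[OF limD[OF h]]])
            (use line_deriv_estimates(1)[OF hol bound x h] in blast)
        assume small: "2 * os_norm V h \<le> 1 - os_norm V x"
        have "x + h \<in> unit_ball V"
          using small os_norm_nonneg[OF h] unit_ballD(2)[OF x] by (intro unit_ball_add x h) linarith
        then have "(\<lambda>n. cmod (f n (x + h) - f n x - line_deriv (f n) x h)) \<longlonglongrightarrow> cmod (g (x + h) - g x - D h)"
          by (intro tendsto_intros lim limD x h)
        then show "cmod (g (x + h) - g x - D h) \<le> cauchy_const x * M * (os_norm V h)\<^sup>2"
          by (rule LIMSEQ_le_const2) (use line_deriv_estimates(2)[OF hol bound x h small] in blast)
      qed
    next
      fix m X assume mX: "0 < m" "X \<in> mat_ball V m"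
      show "cmat_norm m m (\<lambda>i j. g (X i j)) \<le> M"
      proof (rule cmat_norm_limit_le)
        show "(\<lambda>n. f n (X i j)) \<longlonglongrightarrow> g (X i j)" if "i < m" "j < m" for i j
          by (rule lim) (rule mat_ball_in_unit_ball[OF mX(2) that])
        show "\<forall>\<^sub>F n in sequentially. cmat_norm m m (\<lambda>i j. f n (X i j)) \<le> M"
          using order_trans[OF H.cmat_norm_le_os_norm[OF f mX] M] by (intro always_eventually) blast
      qed
    qed (simp add: g_def)
    then show "\<exists>g\<in>carrier (Hcb V scalar_space). \<forall>x\<in>unit_ball V. (\<lambda>n. f n x) \<longlonglongrightarrow> g x"
      by (intro bexI[of _ g] ballI lim)
  qed
  then show ?thesis unfolding fspace_Hcb .
qed

end

section \<open>The predual\<close>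

text \<open>The permutation relating \<open>(\<phi>\<^sub>i\<^sub>j(f\<^sub>k\<^sub>l))\<close>, with outer indices \<open>i, j\<close>, to the same matrix with
  outer indices \<open>k, l\<close>.\<close>

lemma cmat_norm_swap:
  assumes "0 < m" "0 < n"
  shows "cmat_norm (n * m) (n * m) (\<lambda>p q. A (p div m) (q div m) (p mod m) (q mod m))
    = cmat_norm (m * n) (m * n) (\<lambda>p q. A (p mod n) (q mod n) (p div n) (q div n))"
proof -
  \<comment> \<open>Sends the pair index k b + i to i a + k, that is, exchanges outer and inner
    index; \<open>\<sigma> b a\<close> is the inverse.\<close>
  define \<sigma> where "\<sigma> a b p = (p mod b) * a + p div b" for a b p :: nat
  have range: "\<sigma> a b p < b * a" if "p < a * b" "0 < b" for a b p
  proof -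
    have "p div b < a" using that by (simp add: less_mult_imp_div_less)
    moreover have "Suc (p mod b) * a \<le> b * a" using that by (intro mult_right_mono) (simp_all add: Suc_leI)
    ultimately show ?thesis by (simp add: \<sigma>_def)
  qed
  have div: "\<sigma> a b p div a = p mod b" and mod: "\<sigma> a b p mod a = p div b" if "p < a * b" for a b p
  proof -
    have "p div b < a" using that by (simp add: less_mult_imp_div_less)
    then show "\<sigma> a b p div a = p mod b" "\<sigma> a b p mod a = p div b" by (simp_all add: \<sigma>_def)
  qed
  have inv: "\<sigma> b a (\<sigma> a b p) = p" if "p < a * b" for a b p
    using div[OF that] mod[OF that] by (simp add: \<sigma>_def[of b])
  have "bij_betw (\<sigma> n m) {..<n * m} {..<n * m}"
    by (rule bij_betw_byWitness[where f' = "\<sigma> m n"])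
      (use range[of _ n m] range[of _ m n] inv[of _ n m] inv[of _ m n] assms in \<open>auto simp: mult.commute\<close>)
  from cmat_norm_permute[OF this, of "\<lambda>p q. A (p mod n) (q mod n) (p div n) (q div n)"]
  have "cmat_norm (n * m) (n * m) (\<lambda>p q. A (\<sigma> n m p mod n) (\<sigma> n m q mod n) (\<sigma> n m p div n) (\<sigma> n m q div n))
    = cmat_norm (n * m) (n * m) (\<lambda>p q. A (p mod n) (q mod n) (p div n) (q div n))" .
  moreover have "cmat_norm (n * m) (n * m) (\<lambda>p q. A (\<sigma> n m p mod n) (\<sigma> n m q mod n) (\<sigma> n m p div n) (\<sigma> n m q div n))
    = cmat_norm (n * m) (n * m) (\<lambda>p q. A (p div m) (q div m) (p mod m) (q mod m))"
    by (rule cmat_norm_cong) (simp add: div mod)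
  ultimately show ?thesis by (simp add: mult.commute)
qed

lemma (in ruan_space) csubspace_closure_of:
  assumes S: "csubspace S" "S \<subseteq> carrier V"
  shows "csubspace (os_topology V closure_of S)"
  unfolding os_topology_closure_of[OF S(2)]
proof (rule complex_vector.subspaceI)
  show "0 \<in> {x \<in> carrier V. \<forall>r>0. \<exists>y\<in>S. os_norm V (x - y) < r}"
    using complex_vector.subspace_0[OF S(1)] by (auto intro!: bexI[of _ 0])
next
  fix x x' assume x: "x \<in> {x \<in> carrier V. \<forall>r>0. \<exists>y\<in>S. os_norm V (x - y) < r}"
    and x': "x' \<in> {x \<in> carrier V. \<forall>r>0. \<exists>y\<in>S. os_norm V (x - y) < r}"
  show "x + x' \<in> {x \<in> carrier V. \<forall>r>0. \<exists>y\<in>S. os_norm V (x - y) < r}"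
  proof (intro CollectI conjI allI impI)
    show "x + x' \<in> carrier V" using x x' by (simp add: carrier_add)
    fix r :: real assume "0 < r"
    then have "0 < r / 2" by simp
    with x x' obtain y y' where y: "y \<in> S" "os_norm V (x - y) < r / 2" and y': "y' \<in> S" "os_norm V (x' - y') < r / 2"
      by blast
    have "os_norm V ((x - y) + (x' - y')) \<le> os_norm V (x - y) + os_norm V (x' - y')"
      using x x' y(1) y'(1) S(2) by (intro os_norm_triangle carrier_diff) auto
    then have "os_norm V (x + x' - (y + y')) < r" using y(2) y'(2) by (simp add: algebra_simps)
    then show "\<exists>y\<in>S. os_norm V (x + x' - y) < r"
      using complex_vector.subspace_add[OF S(1) y(1) y'(1)] by blast
  qed
next
  fix c x assume x: "x \<in> {x \<in> carrier V. \<forall>r>0. \<exists>y\<in>S. os_norm V (x - y) < r}"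
  show "c *\<^sub>C x \<in> {x \<in> carrier V. \<forall>r>0. \<exists>y\<in>S. os_norm V (x - y) < r}"
  proof (intro CollectI conjI allI impI)
    show "c *\<^sub>C x \<in> carrier V" using x by (simp add: carrier_scaleC)
    fix r :: real assume "0 < r"
    then have r: "0 < r / (cmod c + 1)" by (simp add: add_nonneg_pos)
    with x obtain y where y: "y \<in> S" "os_norm V (x - y) < r / (cmod c + 1)" by blast
    have d: "x - y \<in> carrier V" using x y(1) S(2) by (auto intro: carrier_diff)
    have "os_norm V (c *\<^sub>C x - c *\<^sub>C y) = cmod c * os_norm V (x - y)"
      using os_norm_scaleC[OF d] by (simp add: complex_vector.scale_right_diff_distrib)
    also have "\<dots> \<le> (cmod c + 1) * os_norm V (x - y)"
      using os_norm_nonneg[OF d] by (intro mult_right_mono) auto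
    also have "\<dots> < r"
      using y(2) by (simp add: pos_less_divide_eq add_nonneg_pos mult.commute)
    finally show "\<exists>z\<in>S. os_norm V (c *\<^sub>C x - z) < r"
      using complex_vector.subspace_scale[OF S(1) y(1)] by blast
  qed
qed

section \<open>Evaluations and their closed span\<close>

context ruan_space
begin

abbreviation "H \<equiv> Hcb V scalar_space"

interpretation H: operator_space H
  by (rule operator_space_Hcb)

interpretation H: ruan_space H
  using operator_space_Hcb by (simp add: operator_space_iff)

interpretation H': ruan_space "dual_space H"
  using H.operator_space_dual by (simp add: operator_space_iff)

lemma mnorm_Hcb: "mnorm H = amp_norm V scalar_space"
  by (simp add: Hcb_def)

lemma Hcb_cmod_le: "f \<in> carrier H \<Longrightarrow> x \<in> unit_ball V \<Longrightarrow> cmod (f x) \<le> os_norm H f"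
  using amp_space.cmod_le_os_norm[OF amp_space_Hcb] unfolding fspace_Hcb .

lemma functional_on_HcbI:
  assumes "\<And>f g. f \<in> carrier H \<Longrightarrow> g \<in> carrier H \<Longrightarrow> \<phi> (f + g) = \<phi> f + \<phi> g"
    and "\<And>c f. f \<in> carrier H \<Longrightarrow> \<phi> (c *\<^sub>C f) = c * \<phi> f"
    and "0 \<le> C" "\<And>f. f \<in> carrier H \<Longrightarrow> cmod (\<phi> f) \<le> C * os_norm H f"
    and "\<And>f. f \<notin> carrier H \<Longrightarrow> \<phi> f = 0"
  shows "\<phi> \<in> carrier (dual_space H)" "os_norm (dual_space H) \<phi> \<le> C"
proof -
  show "\<phi> \<in> carrier (dual_space H)"
    unfolding dual_carrier_iff[OF H.ruan_space_axioms] using assms by blast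
  then show "os_norm (dual_space H) \<phi> \<le> C"
    using assms(3,4) by (rule H.dual_os_norm_le)
qed

lemma evaluation_apply [simp]: "f \<in> carrier H \<Longrightarrow> evaluation V x f = f x"
  by (simp add: evaluation_def)

lemma evaluation_in_dual: "x \<in> unit_ball V \<Longrightarrow> evaluation V x \<in> carrier (dual_space H)"
  by (rule functional_on_HcbI(1)[where C = 1])
    (simp_all add: H.carrier_add H.carrier_scaleC Hcb_cmod_le scaleC_fun_apply, simp add: evaluation_def)

lemma span_evaluation_subset: "cspan (evaluation V ` unit_ball V) \<subseteq> carrier (dual_space H)"
  using complex_vector.span_minimal[OF _ H'.subspace_carrier] evaluation_in_dual by blast

lemma Gcb_eq: "Gcb V = {g \<in> carrier (dual_space H). \<forall>r>0. \<exists>y\<in>cspan (evaluation V ` unit_ball V).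
    os_norm (dual_space H) (g - y) < r}"
  unfolding Gcb_def by (rule H'.os_topology_closure_of[OF span_evaluation_subset])

lemma csubspace_Gcb: "csubspace (Gcb V)"
  unfolding Gcb_def by (intro H'.csubspace_closure_of complex_vector.subspace_span span_evaluation_subset)

lemma closedin_Gcb: "closedin (os_topology (dual_space H)) (Gcb V)"
  unfolding Gcb_def by (rule closedin_closure_of)

lemma Gcb_subset: "Gcb V \<subseteq> carrier (dual_space H)"
  by (auto simp: Gcb_eq)

lemma span_subset_Gcb: "cspan (evaluation V ` unit_ball V) \<subseteq> Gcb V"
  unfolding Gcb_def using span_evaluation_subset by (intro closure_of_subset) simp

lemma evaluation_in_Gcb: "x \<in> unit_ball V \<Longrightarrow> evaluation V x \<in> Gcb V"
  using span_subset_Gcb complex_vector.span_base by blast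

abbreviation "G \<equiv> sub_opspace (dual_space H) (Gcb V)"

lemma operator_space_G: "operator_space G"
  by (rule operator_space_sub[OF H.operator_space_dual csubspace_Gcb closedin_Gcb])

interpretation G: ruan_space G
  using operator_space_G by (simp add: operator_space_iff)

text \<open>After exchanging index pairs, the evaluations at X applied to a function matrix F become
  F applied to X, whose norm is at most that of F because X lies in the matrix ball.\<close>

lemma mnorm_evaluation_le:
  assumes m: "0 < m" and X: "X \<in> mat_ball V m"
  shows "mnorm (dual_space H) m (\<lambda>i j. evaluation V (X i j)) \<le> 1"
proof (rule H.dual_mnorm_leI)
  fix n F assume n: "0 < n" and F: "F \<in> mat_ball H n"
  have "F k l \<in> carrier H" if "k < n" "l < n" for k l
    using matsD[OF mat_ballD(1)[OF F] that] .
  then have "cmat_norm (m * n) (m * n) (mat_apply n (\<lambda>i j. evaluation V (X i j)) F)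
      = cmat_norm (m * n) (m * n) (\<lambda>p q. F (p mod n) (q mod n) (X (p div n) (q div n)))"
    using n by (intro cmat_norm_cong) (simp add: mat_apply_def)
  also have "\<dots> = cmat_norm (n * m) (n * m) (mat_apply m F X)"
    unfolding mat_apply_def by (rule cmat_norm_swap[OF m n, symmetric])
  also have "\<dots> \<le> mnorm H n F"
    using amp_space.cmat_norm_le_amp_norm[OF amp_space_Hcb _ m X, of F n] mat_ballD(1)[OF F]
    by (simp add: fspace_Hcb mnorm_Hcb)
  also have "\<dots> \<le> 1" using mat_ballD(2)[OF F] by simp
  finally show "cmat_norm (m * n) (m * n) (mat_apply n (\<lambda>i j. evaluation V (X i j)) F) \<le> 1" .
qed

section \<open>Complete isometry and injectivity of the canonical map\<close>

abbreviation "J \<equiv> canonical_map (Gcb V)"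

lemma J_apply [simp]: "g \<in> Gcb V \<Longrightarrow> J f g = g f"
  by (simp add: canonical_map_def)

lemma J_in_dual:
  assumes f: "f \<in> carrier H"
  shows "J f \<in> carrier (dual_space G)"
  unfolding dual_carrier_iff[OF G.ruan_space_axioms] carrier_sub_opspace
proof (intro conjI ballI allI impI exI[of _ "os_norm H f"])
  fix g assume g: "g \<in> Gcb V"
  show "cmod (J f g) \<le> os_norm H f * os_norm G g"
    using H.dual_cmod_le[of g f] g f Gcb_subset by (auto simp: mult.commute)
next
  fix g g' assume "g \<in> Gcb V" "g' \<in> Gcb V"
  then show "J f (g + g') = J f g + J f g'" using G.carrier_add[of g g'] by simp
next
  fix c g assume "g \<in> Gcb V"
  then show "J f (c *\<^sub>C g) = c * J f g"
    using G.carrier_scaleC[of g c] by (simp add: scaleC_fun_apply)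
qed (simp_all add: canonical_map_def H.os_norm_nonneg[OF f])

lemma clinear_J: "clinear_map H (dual_space G) J"
  unfolding clinear_map_def
proof (intro conjI ballI allI image_subsetI J_in_dual)
  have lin: "clinear_map H scalar_space g" if "g \<in> Gcb V" for g
    using that Gcb_subset by (intro dual_clinear) blast
  show "J (f + f') = J f + J f'" if "f \<in> carrier H" "f' \<in> carrier H" for f f'
    by (auto simp: canonical_map_def fun_eq_iff functional_add[OF lin that])
  show "J (c *\<^sub>C f) = c *\<^sub>C J f" if "f \<in> carrier H" for c f
    by (auto simp: canonical_map_def fun_eq_iff functional_scaleC[OF lin that] scaleC_fun_apply)
qed

text \<open>For the upper bound, J(F) applied to a matrix g over G is, up to exchange of index
  pairs, g applied to F, and g has norm below 1. For the lower bound, F(X) is J(F) applied to the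
  matrix of evaluations at X, which has norm at most 1.\<close>

lemma isometric_J:
  assumes n: "0 < n" and F: "F \<in> mats H n"
  shows "mnorm (dual_space G) n (\<lambda>k l. J (F k l)) = mnorm H n F"
proof (rule order_antisym)
  let ?JF = "\<lambda>k l. J (F k l)"
  show "mnorm (dual_space G) n ?JF \<le> mnorm H n F"
  proof (rule G.dual_mnorm_leI)
    fix m g assume m: "0 < m" and g: "g \<in> mat_ball G m"
    have gG: "g i j \<in> Gcb V" if "i < m" "j < m" for i j
      using matsD[OF mat_ballD(1)[OF g] that] by simp
    have "cmat_norm (n * m) (n * m) (mat_apply m ?JF g)
        = cmat_norm (n * m) (n * m) (\<lambda>p q. g (p mod m) (q mod m) (F (p div m) (q div m)))"
      using m by (intro cmat_norm_cong) (simp add: mat_apply_def gG)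
    also have "\<dots> = cmat_norm (m * n) (m * n) (mat_apply n g F)"
      unfolding mat_apply_def by (rule cmat_norm_swap[OF m n, where A = "\<lambda>k l i j. g i j (F k l)"])
    also have "\<dots> \<le> mnorm (dual_space H) m g * mnorm H n F"
      using gG Gcb_subset by (intro H.dual_cmat_norm_le n F matsI) blast
    also have "\<dots> \<le> 1 * mnorm H n F"
      using mat_ballD(2)[OF g] H.mnorm_nonneg[OF n F] by (intro mult_right_mono) auto
    finally show "cmat_norm (n * m) (n * m) (mat_apply m ?JF g) \<le> mnorm H n F" by simp
  qed
  show "mnorm H n F \<le> mnorm (dual_space G) n ?JF"
    unfolding mnorm_Hcb
  proof (rule amp_space.amp_norm_leI[OF amp_space_Hcb])
    fix m X assume m: "0 < m" and X: "X \<in> mat_ball V m"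
    let ?E = "\<lambda>i j. evaluation V (X i j)"
    have JF: "?JF \<in> mats (dual_space G) n"
      using F by (intro matsI J_in_dual) (auto dest: matsD)
    have E: "?E \<in> mats G m"
      using mat_ball_in_unit_ball[OF X] by (intro matsI) (simp add: evaluation_in_Gcb)
    interpret G': ruan_space "dual_space G"
      using G.operator_space_dual by (simp add: operator_space_iff)
    have "F k l \<in> carrier H" if "k < n" "l < n" for k l using F that by (rule matsD)
    moreover have "?E i j \<in> Gcb V" if "i < m" "j < m" for i j
      using matsD[OF E that] by simp
    ultimately have "cmat_norm (n * m) (n * m) (mat_apply m F X) = cmat_norm (n * m) (n * m) (mat_apply m ?JF ?E)"
      using m by (intro cmat_norm_cong) (simp add: mat_apply_def less_mult_imp_div_less)
    also have "\<dots> \<le> mnorm (dual_space G) n ?JF * mnorm G m ?E"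
      by (rule G.dual_cmat_norm_le[OF JF m E])
    also have "\<dots> \<le> mnorm (dual_space G) n ?JF * 1"
      using mnorm_evaluation_le[OF m X] G'.mnorm_nonneg[OF n JF] by (intro mult_left_mono) auto
    finally show "cmat_norm (n * m) (n * m) (mat_apply m F X) \<le> mnorm (dual_space G) n ?JF" by simp
  qed
qed

lemma inj_on_J: "inj_on J (carrier H)"
proof (rule inj_onI)
  fix f f' assume f: "f \<in> carrier H" and f': "f' \<in> carrier H" and eq: "J f = J f'"
  have "f x = f' x" for x
  proof (cases "x \<in> unit_ball V")
    case True
    from fun_cong[OF eq, of "evaluation V x"] evaluation_in_Gcb[OF True] f f' show ?thesis by simp
  qed (simp add: Hcb_outside[OF f] Hcb_outside[OF f'])
  then show "f = f'" by auto
qed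

text \<open>The derivative of \<open>x \<mapsto> \<delta>(x)\<close> at \<open>x\<close> in direction \<open>h\<close>.\<close>

definition devaluation :: "'a \<Rightarrow> 'a \<Rightarrow> ('a \<Rightarrow> complex) \<Rightarrow> complex" where
  "devaluation x h = (\<lambda>f. if f \<in> carrier H then line_deriv f x h else 0)"

section \<open>Norm differentiability of the evaluation map\<close>

context
  fixes x assumes x: "x \<in> unit_ball V"
begin

text \<open>In the Cauchy estimate the supremum of f is bounded by \<open>os_norm H f\<close>, so
  the derivative in a fixed direction is a bounded functional of f.\<close>

lemma devaluation_in_dual:
  assumes h: "h \<in> carrier V"
  shows "devaluation x h \<in> carrier (dual_space H)"
    and "os_norm (dual_space H) (devaluation x h) \<le> cauchy_const x * os_norm V h"
proof -
  note der = holomorphic_line_derivative(2)[OF Hcb_holomorphic x h]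
  have add: "line_deriv (f + g) x h = line_deriv f x h + line_deriv g x h"
    if "f \<in> carrier H" "g \<in> carrier H" for f g
    unfolding line_deriv_def[of "f + g"] plus_fun_apply
    by (rule DERIV_imp_deriv) (intro DERIV_add der that)
  have scale: "line_deriv (c *\<^sub>C f) x h = c * line_deriv f x h" if "f \<in> carrier H" for c f
    unfolding line_deriv_def[of "c *\<^sub>C f"] scaleC_fun_apply
    by (rule DERIV_imp_deriv) (intro DERIV_cmult der that)
  have bound: "cmod (line_deriv f x h) \<le> (cauchy_const x * os_norm V h) * os_norm H f" if "f \<in> carrier H" for f
    using line_deriv_estimates(1)[OF Hcb_holomorphic[OF that] Hcb_cmod_le[OF that] x h] by (simp add: mult_ac)
  have "0 \<le> cauchy_const x * os_norm V h"
    using cauchy_const_nonneg[OF x] os_norm_nonneg[OF h] by simp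
  note I = functional_on_HcbI[OF _ _ this, of "devaluation x h"]
  show "devaluation x h \<in> carrier (dual_space H)"
    by (rule I(1)) (simp_all add: devaluation_def add scale bound H.carrier_add H.carrier_scaleC)
  show "os_norm (dual_space H) (devaluation x h) \<le> cauchy_const x * os_norm V h"
    by (rule I(2)) (simp_all add: devaluation_def add scale bound H.carrier_add H.carrier_scaleC)
qed

text \<open>The remainder estimate holds for every f with the factor \<open>os_norm H f\<close>,
  hence in the norm of H': delta is Frechet differentiable as a map into H'.\<close>

lemma devaluation_remainder:
  assumes h: "h \<in> carrier V" and small: "2 * os_norm V h \<le> 1 - os_norm V x"
  shows "x + h \<in> unit_ball V"
    and "os_norm (dual_space H) (evaluation V (x + h) - evaluation V x - devaluation x h)
      \<le> cauchy_const x * (os_norm V h)\<^sup>2"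
proof -
  show xh: "x + h \<in> unit_ball V"
    using small os_norm_nonneg[OF h] unit_ballD(2)[OF x] by (intro unit_ball_add x h) linarith
  show "os_norm (dual_space H) (evaluation V (x + h) - evaluation V x - devaluation x h)
      \<le> cauchy_const x * (os_norm V h)\<^sup>2"
  proof (rule H.dual_os_norm_le)
    show "evaluation V (x + h) - evaluation V x - devaluation x h \<in> carrier (dual_space H)"
      by (intro H'.carrier_diff evaluation_in_dual xh x devaluation_in_dual h)
    show "0 \<le> cauchy_const x * (os_norm V h)\<^sup>2" using cauchy_const_nonneg[OF x] by simp
    fix f assume f: "f \<in> carrier H"
    from line_deriv_estimates(2)[OF Hcb_holomorphic[OF f] Hcb_cmod_le[OF f] x h small] f
    show "cmod ((evaluation V (x + h) - evaluation V x - devaluation x h) f)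
        \<le> cauchy_const x * (os_norm V h)\<^sup>2 * os_norm H f"
      by (simp add: devaluation_def mult_ac)
  qed
qed

lemma devaluation_add:
  assumes "h \<in> carrier V" "k \<in> carrier V"
  shows "devaluation x (h + k) = devaluation x h + devaluation x k"
  using functional_add[OF holomorphic_line_derivative(1)[OF Hcb_holomorphic x] assms]
  by (auto simp: devaluation_def)

lemma devaluation_scaleC:
  assumes "h \<in> carrier V"
  shows "devaluation x (c *\<^sub>C h) = c *\<^sub>C devaluation x h"
  using functional_scaleC[OF holomorphic_line_derivative(1)[OF Hcb_holomorphic x] assms]
  by (auto simp: devaluation_def scaleC_fun_apply)

text \<open>The difference quotients of delta lie in the span of the evaluations, and by the
  quadratic remainder their distance to the derivative is of order t.\<close>

lemma devaluation_in_Gcb: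
  assumes h: "h \<in> carrier V"
  shows "devaluation x h \<in> Gcb V"
  unfolding Gcb_eq
proof (intro CollectI conjI allI impI devaluation_in_dual(1)[OF h])
  fix r :: real assume r: "0 < r"
  define a where "a = os_norm V h"
  define c where "c = cauchy_const x"
  have a: "0 \<le> a" and c: "0 \<le> c" using os_norm_nonneg[OF h] cauchy_const_nonneg[OF x] by (simp_all add: a_def c_def)
  \<comment> \<open>The first entry makes the remainder estimate applicable to
    \<open>t *\<^sub>C h\<close>; the second makes the error \<open>c * a\<^sup>2 * t\<close>
    smaller than \<open>r\<close>. The added ones keep the denominators positive.\<close>
  define t where "t = min ((1 - os_norm V x) / (2 * (a + 1))) (r / (c * a\<^sup>2 + 1))"
  have t: "0 < t" using r a c unit_ballD(2)[OF x] by (simp add: t_def add_nonneg_pos)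
  have th: "complex_of_real t *\<^sub>C h \<in> carrier V" using h by (rule carrier_scaleC)
  have norm_th: "os_norm V (complex_of_real t *\<^sub>C h) = t * a"
    using t by (simp add: os_norm_scaleC[OF h] a_def)
  have "t \<le> (1 - os_norm V x) / (2 * (a + 1))" by (simp add: t_def)
  then have "t * (2 * (a + 1)) \<le> 1 - os_norm V x" using a by (simp add: pos_le_divide_eq)
  then have "2 * os_norm V (complex_of_real t *\<^sub>C h) \<le> 1 - os_norm V x"
    using t by (simp add: norm_th distrib_left)
  note rem = devaluation_remainder[OF th this]
  let ?d = "evaluation V (x + complex_of_real t *\<^sub>C h) - evaluation V x"
  define y where "y = complex_of_real (1 / t) *\<^sub>C ?d"
  have y: "y \<in> cspan (evaluation V ` unit_ball V)"
    unfolding y_def using rem(1) x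
    by (intro complex_vector.span_scale complex_vector.span_diff complex_vector.span_base) auto
  have "complex_of_real (1 / t) *\<^sub>C complex_of_real t *\<^sub>C devaluation x h = devaluation x h"
    using t by (simp add: scaleC_scaleC scaleC_one)
  then have y_eq: "complex_of_real (1 / t) *\<^sub>C (?d - devaluation x (complex_of_real t *\<^sub>C h)) = y - devaluation x h"
    by (simp only: y_def complex_vector.scale_right_diff_distrib devaluation_scaleC[OF h])
  have "os_norm (dual_space H) (devaluation x h - y) = os_norm (dual_space H) (y - devaluation x h)"
    using y span_evaluation_subset devaluation_in_dual(1)[OF h] by (intro H'.os_norm_minus_commute) auto
  also have "\<dots> = cmod (complex_of_real (1 / t)) * os_norm (dual_space H) (?d - devaluation x (complex_of_real t *\<^sub>C h))"
    unfolding y_eq[symmetric]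
    by (intro H'.os_norm_scaleC H'.carrier_diff evaluation_in_dual rem(1) x devaluation_in_dual(1)[OF th])
  also have "\<dots> = os_norm (dual_space H) (?d - devaluation x (complex_of_real t *\<^sub>C h)) / t"
    using t by (simp add: norm_divide)
  also have "\<dots> \<le> c * (t * a)\<^sup>2 / t"
    using rem(2) t unfolding norm_th c_def[symmetric] by (intro divide_right_mono) auto
  also have "\<dots> = c * a\<^sup>2 * t" using t by (simp add: power2_eq_square)
  also have "\<dots> < (c * a\<^sup>2 + 1) * t" using t by simp
  also have "\<dots> \<le> (c * a\<^sup>2 + 1) * (r / (c * a\<^sup>2 + 1))"
    using c by (intro mult_left_mono) (simp_all add: t_def)
  also have "\<dots> = r" using c by (simp add: add_nonneg_pos less_imp_neq[symmetric])
  finally show "\<exists>y\<in>cspan (evaluation V ` unit_ball V). os_norm (dual_space H) (devaluation x h - y) < r"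
    using y by blast
qed

end

text \<open>The preimage of phi is phi composed with delta. That it lies in H needs both the
  differentiability of delta inside G and the bound on matrices of evaluations.\<close>

lemma surj_J: "carrier (dual_space G) \<subseteq> J ` carrier H"
proof
  fix \<phi> assume \<phi>: "\<phi> \<in> carrier (dual_space G)"
  define C where "C = os_norm (dual_space G) \<phi>"
  interpret G': ruan_space "dual_space G"
    using G.operator_space_dual by (simp add: operator_space_iff)
  have C: "0 \<le> C" using G'.os_norm_nonneg[OF \<phi>] by (simp add: C_def)
  have bound: "cmod (\<phi> g) \<le> C * os_norm (dual_space H) g" if "g \<in> Gcb V" for g
    using G.dual_cmod_le[OF \<phi>, of g] that by (simp add: C_def)
  note lin = dual_clinear[OF \<phi>]
  note add = functional_add[OF lin, simplified]
    and scale = functional_scaleC[OF lin, simplified]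
    and diff = functional_diff[OF lin G.ruan_space_axioms, simplified]
  define f where "f x = (if x \<in> unit_ball V then \<phi> (evaluation V x) else 0)" for x
  have f: "f \<in> carrier H"
  proof (rule HcbI)
    fix x assume x: "x \<in> unit_ball V"
    \<comment> \<open>Chain rule with the bounded linear map \<open>\<phi>\<close>; the candidate
      derivative makes sense because \<open>devaluation x h\<close> lies in \<open>Gcb V\<close>,
      where \<open>\<phi>\<close> is linear and bounded.\<close>
    show "frechet_differentiable_at V scalar_space f x"
    proof (rule frechet_differentiable_atI[OF x, where K = "C * cauchy_const x" and D = "\<lambda>h. \<phi> (devaluation x h)"])
      show "0 \<le> C * cauchy_const x" using C cauchy_const_nonneg[OF x] by simp
      show "clinear_map V scalar_space (\<lambda>h. \<phi> (devaluation x h))"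
        by (simp add: clinear_map_def devaluation_add[OF x] devaluation_scaleC[OF x] add scale
            devaluation_in_Gcb[OF x] scaleC_complex_def)
      fix h assume h: "h \<in> carrier V"
      show "cmod (\<phi> (devaluation x h)) \<le> C * cauchy_const x * os_norm V h"
        using order_trans[OF bound[OF devaluation_in_Gcb[OF x h]] mult_left_mono[OF devaluation_in_dual(2)[OF x h] C]]
        by (simp add: mult.assoc)
      assume small: "2 * os_norm V h \<le> 1 - os_norm V x"
      note rem = devaluation_remainder[OF x h small]
      let ?d = "evaluation V (x + h) - evaluation V x"
      have G: "evaluation V (x + h) \<in> Gcb V" "evaluation V x \<in> Gcb V" "devaluation x h \<in> Gcb V"
        by (intro evaluation_in_Gcb rem(1) x devaluation_in_Gcb h)+
      then have d: "?d \<in> Gcb V" "?d - devaluation x h \<in> Gcb V"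
        using G.carrier_diff by simp_all
      have "f (x + h) - f x - \<phi> (devaluation x h) = \<phi> (?d - devaluation x h)"
        using rem(1) x by (simp add: f_def diff G d)
      then show "cmod (f (x + h) - f x - \<phi> (devaluation x h)) \<le> C * cauchy_const x * (os_norm V h)\<^sup>2"
        using order_trans[OF bound[OF d(2)] mult_left_mono[OF rem(2) C]] by (simp add: mult.assoc)
    qed
  next
    fix m X assume m: "0 < m" and X: "X \<in> mat_ball V m"
    \<comment> \<open>Complete boundedness: \<open>\<phi>\<close> is completely bounded by
      \<open>C\<close>, and the matrix of evaluations has norm at most 1.\<close>
    have E: "(\<lambda>i j. evaluation V (X i j)) \<in> mats G m"
      using mat_ball_in_unit_ball[OF X] by (intro matsI) (simp add: evaluation_in_Gcb)
    have "cmat_norm m m (\<lambda>i j. f (X i j)) = cmat_norm m m (\<lambda>i j. \<phi> (evaluation V (X i j)))"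
      using mat_ball_in_unit_ball[OF X] by (intro cmat_norm_cong) (simp add: f_def)
    also have "\<dots> \<le> C * mnorm G m (\<lambda>i j. evaluation V (X i j))"
      using bound by (intro functional_completely_bounded[OF lin G.ruan_space_axioms C _ m E]) simp
    also have "\<dots> \<le> C * 1"
      using mnorm_evaluation_le[OF m X] C by (intro mult_left_mono) simp_all
    finally show "cmat_norm m m (\<lambda>i j. f (X i j)) \<le> C" by simp
  qed (simp add: f_def)
  have span: "g f = \<phi> g" if "g \<in> cspan (evaluation V ` unit_ball V)" for g
  proof -
    have "cspan (evaluation V ` unit_ball V) \<subseteq> {g \<in> Gcb V. g f = \<phi> g}"
    proof (rule complex_vector.span_minimal)
      show "evaluation V ` unit_ball V \<subseteq> {g \<in> Gcb V. g f = \<phi> g}"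
        using f by (auto simp: evaluation_in_Gcb f_def)
      show "csubspace {g \<in> Gcb V. g f = \<phi> g}"
        using G.carrier_zero G.carrier_add G.carrier_scaleC functional_zero[OF lin G.ruan_space_axioms]
        by (intro complex_vector.subspaceI) (auto simp: add scale scaleC_fun_apply)
    qed
    then show ?thesis using that by blast
  qed
  have "g f = \<phi> g" if g: "g \<in> Gcb V" for g
  proof -
    have K: "0 \<le> os_norm H f + C" using H.os_norm_nonneg[OF f] C by simp
    \<comment> \<open>Evaluation at \<open>f\<close> and \<open>\<phi>\<close> are bounded on
      \<open>Gcb V\<close> by \<open>os_norm H f\<close> and \<open>C\<close>, and agree on the
      span; approximating \<open>g\<close> from the span within \<open>s\<close> and letting
      \<open>s\<close> tend to 0 gives equality.\<close>
    have "cmod (g f - \<phi> g) \<le> (os_norm H f + C) * 0"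
    proof (rule le_mult_of_greater[OF K])
      fix s :: real assume "0 < s"
      with g obtain y where y: "y \<in> cspan (evaluation V ` unit_ball V)" and lt: "os_norm (dual_space H) (g - y) < s"
        unfolding Gcb_eq by blast
      have yG: "y \<in> Gcb V" using y span_subset_Gcb by blast
      have d: "g - y \<in> Gcb V" using G.carrier_diff g yG by simp
      have "g f - \<phi> g = (g - y) f - \<phi> (g - y)"
        using span[OF y] by (simp add: diff g yG)
      then have "cmod (g f - \<phi> g) \<le> cmod ((g - y) f) + cmod (\<phi> (g - y))"
        by (simp only: norm_triangle_ineq4)
      also have "\<dots> \<le> os_norm (dual_space H) (g - y) * os_norm H f + C * os_norm (dual_space H) (g - y)"
        using d Gcb_subset by (intro add_mono H.dual_cmod_le[of "g - y"] f bound) auto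
      also have "\<dots> = (os_norm H f + C) * os_norm (dual_space H) (g - y)"
        by (simp add: distrib_right mult.commute)
      also have "\<dots> \<le> (os_norm H f + C) * s"
        using lt K by (intro mult_left_mono) auto
      finally show "cmod (g f - \<phi> g) \<le> (os_norm H f + C) * s" .
    qed
    then show ?thesis by simp
  qed
  moreover have "\<phi> g = 0" if "g \<notin> Gcb V" for g
    using \<phi> that by (simp add: dual_carrier_iff[OF G.ruan_space_axioms])
  ultimately have "J f = \<phi>" by (auto simp: canonical_map_def)
  then show "\<phi> \<in> J ` carrier H" using f by blast
qed

lemma completely_isometric_iso_J: "completely_isometric_iso H (dual_space G) J"
  unfolding completely_isometric_iso_def bij_betw_def
  using clinear_J inj_on_J surj_J J_in_dual isometric_J by blast

end

theorem theorem4p2: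
  fixes V :: "'v::complex_vector opspace"
  assumes "operator_space V"
  shows "dual_operator_space (Hcb V scalar_space)
       \<and> operator_space_predual (Hcb V scalar_space) (Gcb V)"
proof -
  interpret ruan_space V using assms by (simp add: operator_space_iff)
  \<comment> \<open>The space \<open>G\<close> with the map \<open>J\<close> also serves as witness
    for \<open>dual_operator_space\<close>.\<close>
  show ?thesis
    unfolding dual_operator_space_def operator_space_predual_def
    using operator_space_Hcb operator_space_G completely_isometric_iso_J csubspace_Gcb closedin_Gcb by blast
qed

end
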